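(* The map sending a topograph to its river sequence (written as a binary necklace with $L=0$, $R=1$) is a bijection from the set of primitive integer topographs of non-square positive discriminant (all such discriminants together) to the set of non-repeating binary necklaces of length at least $2$.
   Context: A topograph is a tree drawn in the plane with all vertices of degree 3 whose regions are labelled by integers such that for every edge, if $s,t$ label the regions on either side of it and $r,u$ the other regions at its two endpoints, then $r+u=2(s+t)$; the edge directed from the $r$-end to the $u$-end gets label $s+t-r$ (reverse direction: the negative). A configuration $[a,b,c]$ is a directed edge with label $b$, region $a$ on its left and region $c$ on its right; it corresponds to the form $ax^2+bxy+cy^2$, and $b^2-4ac$ is constant on the topograph (its discriminant). A topograph is determined by any one configuration; two topographs are identified if there is an orientation-preserving, label-preserving isomorphism between them; two forms are $\mathrm{SL}(2,\mathbb Z)$-equivalent iff they occur on the same topograph. Primitive means the gcd of the region labels is $1$. River sequence (non-square $D>0$): the river is the set of edges separating a positive region from a negative region; it is an infinite periodic path. Start at a river edge directed so that the positive region is on its left, i.e. a configuration $q=[a,b,c]$ with $a>0>c$ (a simple form), and walk along the river in that direction; at each vertex record $L$ if the next river edge has the same left (positive) region and $R$ if it has the same right (negative) region; stop upon first reaching an edge whose configuration is again $q$. Algebraically: $q_0=q$, and $q_{j+1}=[a_j,b_j+2a_j,a_j+b_j+c_j]$ (record $L$) if $a_j+b_j+c_j<0$, $q_{j+1}=[a_j+b_j+c_j,b_j+2c_j,c_j]$ (record $R$) if $a_j+b_j+c_j>0$, for $q_j=[a_j,b_j,c_j]$, stopping at the first $j\ge1$ with $q_j=q$. Different starting edges give cyclic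 rotations of the word, so the topograph determines a binary necklace (word up to cyclic rotation). A necklace is non-repeating if it is not a concatenation of two or more copies of a shorter word. *)

theory Defs
  imports Main
begin

text \<open>
  A tree drawn in the plane with all vertices of degree 3 is given by its directed edges
  (darts): \<open>flip\<close> reverses a dart, \<open>turn\<close> rotates a dart
  counterclockwise about its tail to the next dart with the same tail. So vertices are the
  3-element orbits of \<open>turn\<close> and edges the 2-element orbits of \<open>flip\<close>.
  \<open>lab T d\<close> is the label of the region on the left of \<open>d\<close>, hence
  \<open>lab T (flip T d)\<close> that of the region on its right.
\<close>

record 'd topograph =
  darts :: "'d set"
  flip :: "'d \<Rightarrow> 'd"
  turn :: "'d \<Rightarrow> 'd"
  lab :: "'d \<Rightarrow> int"

text \<open>
  On arrival at the head of \<open>d\<close>, the dart pointing back is \<open>flip T d\<close>; the next one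
  counterclockwise is the right turn, the one after that the left turn. A left turn keeps the region
  on the left, a right turn keeps the region on the right.
\<close>

definition right_turn :: "'d topograph \<Rightarrow> 'd \<Rightarrow> 'd" where
  "right_turn T d = turn T (flip T d)"

definition left_turn :: "'d topograph \<Rightarrow> 'd \<Rightarrow> 'd" where
  "left_turn T d = turn T (turn T (flip T d))"

text \<open>
  \<open>walk_rel\<close> relates consecutive darts of a walk without backtracking, so its acyclicity
  says that the graph has no circuit (loops and double edges included).
\<close>

definition walk_rel :: "'d topograph \<Rightarrow> ('d \<times> 'd) set" where
  "walk_rel T = {(d, e). d \<in> darts T \<and> (e = left_turn T d \<or> e = right_turn T d)}"

definition plane_cubic_tree :: "'d topograph \<Rightarrow> bool" where
  "plane_cubic_tree T \<longleftrightarrow>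
     darts T \<noteq> {} \<and>
     (\<forall>d\<in>darts T. flip T d \<in> darts T \<and> flip T d \<noteq> d \<and> flip T (flip T d) = d) \<and>
     (\<forall>d\<in>darts T. turn T d \<in> darts T \<and> turn T d \<noteq> d \<and> turn T (turn T (turn T d)) = d) \<and>
     (\<forall>d\<in>darts T. \<forall>e\<in>darts T.
        (d, e) \<in> {(x, y). x \<in> darts T \<and> (y = flip T x \<or> y = turn T x)}\<^sup>*) \<and>
     acyclic (walk_rel T)"

text \<open>
  The regions at the two ends of \<open>d\<close> that do not border it are the ones on the left of
  \<open>turn T d\<close> (at the tail) and on the left of \<open>right_turn T d\<close> (at the head).
\<close>

definition tail_lab :: "'d topograph \<Rightarrow> 'd \<Rightarrow> int" where
  "tail_lab T d = lab T (turn T d)"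

definition head_lab :: "'d topograph \<Rightarrow> 'd \<Rightarrow> int" where
  "head_lab T d = lab T (right_turn T d)"

definition is_topograph :: "'d topograph \<Rightarrow> bool" where
  "is_topograph T \<longleftrightarrow>
     plane_cubic_tree T \<and>
     (\<forall>d\<in>darts T. lab T (left_turn T d) = lab T d) \<and>
     (\<forall>d\<in>darts T. tail_lab T d + head_lab T d = 2 * (lab T d + lab T (flip T d)))"

definition edge_lab :: "'d topograph \<Rightarrow> 'd \<Rightarrow> int" where
  "edge_lab T d = lab T d + lab T (flip T d) - tail_lab T d"

definition configuration :: "'d topograph \<Rightarrow> 'd \<Rightarrow> int \<times> int \<times> int" where
  "configuration T d = (lab T d, edge_lab T d, lab T (flip T d))"

definition disc :: "int \<times> int \<times> int \<Rightarrow> int" where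
  "disc = (\<lambda>(a, b, c). b\<^sup>2 - 4 * a * c)"

definition has_discriminant :: "'d topograph \<Rightarrow> int \<Rightarrow> bool" where
  "has_discriminant T D \<longleftrightarrow> (\<forall>d\<in>darts T. disc (configuration T d) = D)"

definition primitive :: "'d topograph \<Rightarrow> bool" where
  "primitive T \<longleftrightarrow> Gcd (lab T ` darts T) = 1"

definition topograph_iso :: "('d topograph \<times> 'd topograph) set" where
  "topograph_iso = {(T, T'). is_topograph T \<and> is_topograph T' \<and>
     (\<exists>f. bij_betw f (darts T) (darts T') \<and>
        (\<forall>d\<in>darts T. f (flip T d) = flip T' (f d) \<and> f (turn T d) = turn T' (f d) \<and>
                      lab T' (f d) = lab T d))}"

definition primitive_nonsquare_topographs :: "'d topograph set" where
  "primitive_nonsquare_topographs = {T. is_topograph T \<and> primitive T \<and>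
     (\<exists>D>0. (\<nexists>n. D = n\<^sup>2) \<and> has_discriminant T D)}"

text \<open>River edges are directed so that the positive region is on the left.\<close>

definition river :: "'d topograph \<Rightarrow> 'd set" where
  "river T = {d \<in> darts T. lab T d > 0 \<and> lab T (flip T d) < 0}"

definition river_next :: "'d topograph \<Rightarrow> 'd \<Rightarrow> 'd" where
  "river_next T d = (if left_turn T d \<in> river T then left_turn T d else right_turn T d)"

text \<open>Letter 0 is \<open>L\<close>, letter 1 is \<open>R\<close>.\<close>

definition river_letter :: "'d topograph \<Rightarrow> 'd \<Rightarrow> nat" where
  "river_letter T d = (if left_turn T d \<in> river T then 0 else 1)"

definition river_length :: "'d topograph \<Rightarrow> 'd \<Rightarrow> nat" where
  "river_length T d =
     (LEAST j. j \<ge> 1 \<and> configuration T ((river_next T ^^ j) d) = configuration T d)"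

definition river_word :: "'d topograph \<Rightarrow> 'd \<Rightarrow> nat list" where
  "river_word T d = map (\<lambda>i. river_letter T ((river_next T ^^ i) d)) [0..<river_length T d]"

definition necklace :: "'a list \<Rightarrow> 'a list set" where
  "necklace w = {rotate k w |k. True}"

definition repeating :: "'a list \<Rightarrow> bool" where
  "repeating w \<longleftrightarrow>
     (\<exists>v k. k \<ge> 2 \<and> length v < length w \<and> w = concat (replicate k v))"

definition nonrepeating_binary_necklaces :: "nat list set set" where
  "nonrepeating_binary_necklaces =
     {necklace w |w. w \<in> lists {0, 1} \<and> length w \<ge> 2 \<and> \<not> repeating w}"

text \<open>
  The map on isomorphism classes, lifted as usual for quotients by a union over the
  representatives (topographs and starting edges). Necklaces are the disjoint blocks of the rotation
  relation, so if the union is a necklace then every starting edge gives this same necklace.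
\<close>

definition river_sequence :: "'d topograph set \<Rightarrow> nat list set" where
  "river_sequence C = (\<Union>T\<in>C. \<Union>d\<in>river T. necklace (river_word T d))"

text \<open>The two turns act on configurations by the usual substitutions.\<close>

lemma configuration_left_turn:
  assumes "is_topograph T" "d \<in> darts T" "configuration T d = (a, b, c)"
  shows "configuration T (left_turn T d) = (a, b + 2 * a, a + b + c)"
proof -
  let ?l = "left_turn T d"
  note T = assms(1)[unfolded is_topograph_def plane_cubic_tree_def]
  have fd: "flip T d \<in> darts T" "flip T (flip T d) = d" using T assms(2) by blast+
  have r: "right_turn T d \<in> darts T" using T fd by (auto simp: right_turn_def)
  have l: "?l \<in> darts T" using T r by (auto simp: left_turn_def right_turn_def)
  have tl: "turn T ?l = flip T d" using T fd by (auto simp: left_turn_def)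
  have fl: "flip T ?l \<in> darts T" "flip T (flip T ?l) = ?l" using T l by blast+
  have "left_turn T (flip T ?l) = turn T (turn T ?l)"
    by (simp only: left_turn_def[of T "flip T ?l"] fl(2))
  also have "\<dots> = right_turn T d" by (simp add: tl right_turn_def)
  finally have "lab T (flip T ?l) = lab T (right_turn T d)" using T fl(1) by metis
  moreover have "lab T ?l = lab T d" using T assms(2) by blast
  moreover have "tail_lab T d + head_lab T d = 2 * (lab T d + lab T (flip T d))"
    using T assms(2) by blast
  ultimately show ?thesis using assms(3) tl
    by (auto simp: configuration_def edge_lab_def tail_lab_def head_lab_def)
qed

lemma configuration_right_turn:
  assumes "is_topograph T" "d \<in> darts T" "configuration T d = (a, b, c)"
  shows "configuration T (right_turn T d) = (a + b + c, b + 2 * c, c)"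
proof -
  let ?r = "right_turn T d"
  note T = assms(1)[unfolded is_topograph_def plane_cubic_tree_def]
  have fd: "flip T d \<in> darts T" "flip T (flip T d) = d" using T assms(2) by blast+
  have r: "?r \<in> darts T" using T fd by (auto simp: right_turn_def)
  have fr: "flip T ?r \<in> darts T" "flip T (flip T ?r) = ?r" using T r by blast+
  have "left_turn T (flip T ?r) = flip T d"
    using T fd by (simp add: left_turn_def[of T "flip T ?r"] fr(2)) (simp add: right_turn_def)
  then have "lab T (flip T ?r) = lab T (flip T d)" using T fr(1) by metis
  moreover have "lab T (turn T ?r) = lab T d"
    using T assms(2) by (auto simp: left_turn_def right_turn_def)
  moreover have "tail_lab T d + head_lab T d = 2 * (lab T d + lab T (flip T d))"
    using T assms(2) by blast
  ultimately show ?thesis using assms(3)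
    by (auto simp: configuration_def edge_lab_def tail_lab_def head_lab_def)
qed

end

theory Submission
  imports Defs "HOL-Library.Countable"
begin

text \<open>
  A word \<open>w\<close> with both letters acts on forms as substitution by a hyperbolic matrix with
  nonnegative entries \<open>p, r, s, t\<close>, whose fixed forms are the multiples of
  \<open>(s, t - p, - r)\<close>; as this form has \<open>s > 0 > - r\<close> and rotating the word
  moves it along one step, its walk stays on the river and spells \<open>w\<close>. Hence a primitive
  simple form is recovered from its word, and every non-repeating word arises. A topograph
  is determined by one configuration because two sequences of flips and turns
  that lead from one dart of a plane cubic tree to the same dart do so in every such tree. Its river is connected
  since a walk leaving it climbs forever.
\<close>

subsection \<open>Forms along the river\<close>

text \<open>The matrix of a word with both letters has two real eigenlines, and
  \<open>(s, t - p, - r)\<close> is the form vanishing on them: its roots are the fixed points of z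
  -> (p z + r) / (s z + t). Its discriminant is the squared trace minus 4, which falls strictly
  between two consecutive squares once the trace is at least 3. A word pins down a form only up to a
  factor. The factor is removed in two ways: by primitivity when two topographs are compared, and by
  equality of discriminants when a form is compared with its own successors, which is what makes
  river words non-repeating. Two obstacles come from abstract trees. They carry no coordinates, so
  an isomorphism is built as an orbit of pairs of darts, and the absence of circuits is what makes
  this orbit single valued. Moreover configurations recur along a river, so a tree with a prescribed
  configuration cannot use configurations as darts; transformations of all forms take their
  place.\<close>

fun fstep :: "nat \<Rightarrow> int \<times> int \<times> int \<Rightarrow> int \<times> int \<times> int" where
  "fstep l (a, b, c) = (if l = 0 then (a, b + 2 * a, a + b + c) else (a + b + c, b + 2 * c, c))"

fun river_turn :: "int \<times> int \<times> int \<Rightarrow> nat" where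
  "river_turn (a, b, c) = (if a + b + c < 0 then 0 else 1)"

definition form_next :: "int \<times> int \<times> int \<Rightarrow> int \<times> int \<times> int" where
  "form_next q = fstep (river_turn q) q"

definition form_period :: "int \<times> int \<times> int \<Rightarrow> nat" where
  "form_period q = (LEAST j. j \<ge> 1 \<and> (form_next ^^ j) q = q)"

definition form_word :: "int \<times> int \<times> int \<Rightarrow> nat list" where
  "form_word q = map (\<lambda>i. river_turn ((form_next ^^ i) q)) [0..<form_period q]"

fun is_simple :: "int \<times> int \<times> int \<Rightarrow> bool" where
  "is_simple (a, b, c) \<longleftrightarrow> a > 0 \<and> c < 0"

fun form_dvd :: "int \<Rightarrow> int \<times> int \<times> int \<Rightarrow> bool" where
  "form_dvd g (a, b, c) \<longleftrightarrow> g dvd a \<and> g dvd b \<and> g dvd c"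

definition primitive_form :: "int \<times> int \<times> int \<Rightarrow> bool" where
  "primitive_form q \<longleftrightarrow> (\<forall>g. form_dvd g q \<longrightarrow> is_unit g)"

definition nonsquare_disc :: "int \<times> int \<times> int \<Rightarrow> bool" where
  "nonsquare_disc q \<longleftrightarrow> disc q > 0 \<and> (\<nexists>n. disc q = n\<^sup>2)"

lemma disc_fstep [simp]: "disc (fstep l q) = disc q"
  by (cases q) (simp add: disc_def power2_eq_square algebra_simps)

lemma disc_form_next [simp]: "disc (form_next q) = disc q"
  by (simp add: form_next_def)

lemma disc_funpow_form_next [simp]: "disc ((form_next ^^ k) q) = disc q"
  by (induction k) auto

lemma nonsquare_disc_cong: "disc q = disc q' \<Longrightarrow> nonsquare_disc q = nonsquare_disc q'"
  by (simp add: nonsquare_disc_def)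

text \<open>A form representing 0 has square discriminant: \<open>b\<^sup>2\<close> if an outer
  coefficient vanishes, \<open>(a - c)\<^sup>2\<close> if the value at (1, 1) does. So no region
  next to the river is labelled 0, and the sign of \<open>a + b + c\<close> always decides the next
  letter.\<close>

lemma nonsquare_disc_sum_neq_0:
  assumes "nonsquare_disc (a, b, c)"
  shows "a \<noteq> 0" "c \<noteq> 0" "a + b + c \<noteq> 0"
proof -
  have *: "b\<^sup>2 - 4 * a * c \<noteq> n\<^sup>2" for n
    using assms by (auto simp: nonsquare_disc_def disc_def)
  show "a \<noteq> 0" "c \<noteq> 0" using *[of b] by auto
  show "a + b + c \<noteq> 0"
  proof
    assume "a + b + c = 0"
    then have "b = - (a + c)" by linarith
    then have "b\<^sup>2 - 4 * a * c = (a - c)\<^sup>2" by algebra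
    with * show False by blast
  qed
qed

lemma is_simple_form_next:
  assumes "is_simple q" "nonsquare_disc q"
  shows "is_simple (form_next q)"
  using assms by (cases q) (auto simp: form_next_def dest: nonsquare_disc_sum_neq_0(3))

lemma is_simple_funpow_form_next:
  assumes "is_simple q" "nonsquare_disc q"
  shows "is_simple ((form_next ^^ k) q)"
proof (induction k)
  case (Suc k)
  have "nonsquare_disc ((form_next ^^ k) q)"
    using assms(2) nonsquare_disc_cong[of q "(form_next ^^ k) q"] by simp
  with Suc show ?case by (simp add: is_simple_form_next)
qed (use assms in auto)

text \<open>The letter leading to a simple form \<open>(a, b, c)\<close> is the sign of \<open>a - b + c\<close>.\<close>

lemma form_next_inject:
  assumes "is_simple q" "nonsquare_disc q" "is_simple q'" "nonsquare_disc q'"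
    and "form_next q = form_next q'"
  shows "q = q'"
  using assms by (cases q; cases q') (auto simp: form_next_def split: if_splits)

text \<open>For \<open>a > 0 > c\<close> the discriminant is a sum of nonnegative terms,
  \<open>b\<^sup>2\<close> and \<open>4 * (a * - c)\<close>, so it bounds all three
  coefficients.\<close>

lemma finite_simple_forms: "finite {q. is_simple q \<and> disc q = D}"
proof (rule finite_subset)
  show "{q. is_simple q \<and> disc q = D} \<subseteq> {-D..D} \<times> {-D..D} \<times> {-D..D}"
  proof
    fix q assume q: "q \<in> {q. is_simple q \<and> disc q = D}"
    obtain a b c where abc: "q = (a, b, c)" by (cases q)
    with q have "is_simple (a, b, c)" and D: "disc (a, b, c) = D" by auto
    then have ac: "a \<ge> 1" "- c \<ge> 1" by auto
    have D: "D = b\<^sup>2 + 4 * (a * - c)" using D by (auto simp: disc_def)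
    have 1: "a \<le> a * - c" using mult_left_mono[of 1 "-c" a] ac by simp
    have 2: "- c \<le> a * - c" using mult_right_mono[of 1 a "-c"] ac by simp
    have b2: "\<bar>b\<bar> \<le> b\<^sup>2"
      using self_le_power[of "\<bar>b\<bar>" 2] by (cases "b = 0") auto
    have "b\<^sup>2 \<ge> 0" by simp
    with 1 2 ac b2 D have "\<bar>a\<bar> \<le> D" "\<bar>b\<bar> \<le> D" "\<bar>c\<bar> \<le> D" by linarith+
    then show "q \<in> {-D..D} \<times> {-D..D} \<times> {-D..D}" using abc by auto
  qed
qed auto

text \<open>By pigeonhole the orbit meets itself; injectivity of \<open>form_next\<close> on simple
  forms then moves the collision back to index 0, so the orbit is purely periodic.\<close>

lemma form_next_returns:
  assumes "is_simple q" "nonsquare_disc q"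
  shows "\<exists>j\<ge>1. (form_next ^^ j) q = q"
proof -
  let ?x = "\<lambda>i. (form_next ^^ i) q"
  have simp: "is_simple (?x i)" "nonsquare_disc (?x i)" for i
    using assms is_simple_funpow_form_next nonsquare_disc_cong[of q "?x i"] by auto
  have "\<not> inj ?x"
  proof
    assume "inj ?x"
    moreover have "range ?x \<subseteq> {r. is_simple r \<and> disc r = disc q}" using simp by auto
    ultimately show False
      using finite_simple_forms[of "disc q"] by (meson finite_imageD finite_subset infinite_UNIV_nat)
  qed
  then obtain i j where "i < j" "?x i = ?x j"
    by (metis (mono_tags, lifting) injI nat_neq_iff)
  then show ?thesis
  proof (induction i arbitrary: j)
    case 0
    then show ?case by (intro exI[of _ j]) auto
  next
    case (Suc i)
    then obtain j' where j: "j = Suc j'" by (cases j) auto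
    with Suc.prems have "form_next (?x i) = form_next (?x j')" by simp
    then have "?x i = ?x j'" using form_next_inject simp by blast
    with Suc j show ?case by auto
  qed
qed

lemma form_period:
  assumes "is_simple q" "nonsquare_disc q"
  shows "form_period q \<ge> 1" "(form_next ^^ form_period q) q = q"
  using LeastI_ex[OF form_next_returns[OF assms, unfolded Bex_def]]
  unfolding form_period_def by auto

lemma form_period_le: "j \<ge> 1 \<Longrightarrow> (form_next ^^ j) q = q \<Longrightarrow> form_period q \<le> j"
  unfolding form_period_def by (rule Least_le) auto

lemma form_period_dvd:
  assumes "is_simple q" "nonsquare_disc q" "(form_next ^^ j) q = q"
  shows "form_period q dvd j"
proof (rule ccontr)
  let ?n = "form_period q"
  assume "\<not> ?n dvd j"
  then have "j mod ?n \<ge> 1" by (simp add: dvd_eq_mod_eq_0)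
  moreover have "(form_next ^^ (j mod ?n)) q = q"
    using funpow_mod_eq[OF form_period(2)[OF assms(1,2)], of j] assms(3) by simp
  ultimately have "?n \<le> j mod ?n" by (rule form_period_le)
  with form_period(1)[OF assms(1,2)] show False
    by (metis leD mod_less_divisor less_eq_Suc_le One_nat_def)
qed

lemma length_form_word [simp]: "length (form_word q) = form_period q"
  by (simp add: form_word_def)

lemma form_word_form_next:
  assumes "is_simple q" "nonsquare_disc q"
  shows "form_word (form_next q) = rotate1 (form_word q)"
proof -
  let ?x = "\<lambda>i. (form_next ^^ i) q"
  let ?n = "form_period q"
  have simp: "is_simple (?x i)" "nonsquare_disc (?x i)" for i
    using assms is_simple_funpow_form_next nonsquare_disc_cong[of q "?x i"] by auto
  have "(form_next ^^ j) (form_next q) = form_next q \<longleftrightarrow> ?x j = q" for j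
  proof -
    have "(form_next ^^ j) (form_next q) = form_next (?x j)" by (simp add: funpow_swap1)
    then show ?thesis using form_next_inject[OF simp assms] by auto
  qed
  then have per: "form_period (form_next q) = ?n" by (simp add: form_period_def)
  obtain m where m: "?n = Suc m" using form_period(1)[OF assms] by (cases ?n) auto
  let ?h = "\<lambda>i. river_turn (?x i)"
  have "form_word (form_next q) = map (\<lambda>i. ?h (Suc i)) [0..<?n]"
    by (simp add: form_word_def per funpow_swap1)
  also have "\<dots> = map (\<lambda>i. ?h (Suc i)) [0..<m] @ [?h ?n]" by (simp add: m)
  also have "?h ?n = ?h 0" using form_period(2)[OF assms] by simp
  also have "map (\<lambda>i. ?h (Suc i)) [0..<m] @ [?h 0] = rotate1 (map ?h [0..<Suc m])"
    by (simp add: map_upt_Suc del: upt_Suc)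
  finally show ?thesis by (simp add: form_word_def m)
qed

lemma form_word_funpow:
  assumes "is_simple q" "nonsquare_disc q"
  shows "form_word ((form_next ^^ k) q) = rotate k (form_word q)"
proof (induction k)
  case (Suc k)
  have "nonsquare_disc ((form_next ^^ k) q)"
    using assms nonsquare_disc_cong[of q "(form_next ^^ k) q"] by simp
  then show ?case
    using Suc form_word_form_next is_simple_funpow_form_next[OF assms] by simp
qed auto

lemma river_turn_binary: "river_turn q = 0 \<or> river_turn q = 1"
  by (cases q) auto

lemma form_word_binary: "form_word q \<in> lists {0, 1}"
proof -
  have "river_turn r \<in> {0, 1}" for r using river_turn_binary[of r] by blast
  then show ?thesis by (auto simp: form_word_def in_lists_conv_set)
qed

subsection \<open>The form fixed by a word\<close>

fun word_act :: "nat list \<Rightarrow> int \<times> int \<times> int \<Rightarrow> int \<times> int \<times> int" where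
  "word_act [] q = q"
| "word_act (l # w) q = word_act w (fstep l q)"

text \<open>\<open>(p, r, s, t)\<close> stands for the matrix with rows \<open>(p, r)\<close> and \<open>(s, t)\<close>; the letters
  stand for the unipotent matrices \<open>(1, 1, 0, 1)\<close> and \<open>(1, 0, 1, 1)\<close>.\<close>

fun word_mat :: "nat list \<Rightarrow> int \<times> int \<times> int \<times> int" where
  "word_mat [] = (1, 0, 0, 1)"
| "word_mat (l # w) = (case word_mat w of (p, r, s, t) \<Rightarrow>
     if l = 0 then (p + s, r + t, s, t) else (p, r, p + s, r + t))"

definition fixed_form :: "nat list \<Rightarrow> int \<times> int \<times> int" where
  "fixed_form w = (case word_mat w of (p, r, s, t) \<Rightarrow> (s, t - p, - r))"

lemma word_act_append: "word_act (u @ w) q = word_act w (word_act u q)"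
  by (induction u arbitrary: q) auto

text \<open>Substitution is a right action: the letter applied first contributes the leftmost matrix
  factor, matching the recursion of \<open>word_mat\<close>.\<close>

lemma word_act_eq_substitution:
  assumes "word_mat w = (p, r, s, t)"
  shows "word_act w (a, b, c) = (a * p\<^sup>2 + b * p * s + c * s\<^sup>2,
    2 * a * p * r + b * (p * t + r * s) + 2 * c * s * t, a * r\<^sup>2 + b * r * t + c * t\<^sup>2)"
  using assms
proof (induction w arbitrary: p r s t a b c)
  case (Cons l w)
  obtain p' r' s' t' where w: "word_mat w = (p', r', s', t')" by (cases "word_mat w") auto
  show ?case using Cons.prems unfolding word_act.simps fstep.simps
    by (cases "l = 0") (auto simp: w Cons.IH[OF w] power2_eq_square algebra_simps)
qed auto

lemma word_mat_snoc:
  "word_mat (w @ [l]) = (case word_mat w of (p, r, s, t) \<Rightarrow>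
     if l = 0 then (p, p + r, s, s + t) else (p + r, r, s + t, t))"
  by (induction w) (auto split: prod.splits)

text \<open>Both letter matrices have determinant 1, and multiplying by them never decreases an
  entry. Hence the first occurrence of either letter leaves a positive off-diagonal entry for
  good.\<close>

lemma word_mat_props:
  assumes "word_mat w = (p, r, s, t)"
  shows "p \<ge> 1 \<and> t \<ge> 1 \<and> r \<ge> 0 \<and> s \<ge> 0 \<and> p * t - r * s = 1 \<and>
    (0 \<in> set w \<longrightarrow> r \<ge> 1) \<and> ((\<exists>l\<in>set w. l \<noteq> 0) \<longrightarrow> s \<ge> 1)"
  using assms
proof (induction w arbitrary: p r s t)
  case (Cons l w)
  obtain p' r' s' t' where w: "word_mat w = (p', r', s', t')" by (cases "word_mat w") auto
  show ?case using Cons.prems Cons.IH[OF w]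
    by (cases "l = 0") (auto simp: w algebra_simps)
qed auto

text \<open>Substituting a matrix A of determinant 1 turns the fixed form of M into that of the
  conjugate A^(-1) M A. For M = A B this conjugate is B A, the matrix of the rotated word.\<close>

lemma fstep_fixed_form: "fstep l (fixed_form (l # w)) = fixed_form (w @ [l])"
  by (auto simp: fixed_form_def word_mat_snoc split: prod.splits)

lemma word_act_fixed_form: "word_act u (fixed_form (u @ x)) = fixed_form (x @ u)"
proof (induction u arbitrary: x)
  case (Cons l u)
  then show ?case using Cons.IH[of "x @ [l]"] by (simp add: fstep_fixed_form)
qed simp

lemma is_simple_fixed_form:
  assumes "0 \<in> set w" "\<exists>l\<in>set w. l \<noteq> 0"
  shows "is_simple (fixed_form w)"
  using assms word_mat_props[of w] by (auto simp: fixed_form_def split: prod.splits)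

text \<open>With both letters present \<open>r * s \<ge> 1\<close>, hence
  \<open>p * t \<ge> 2\<close> and the trace \<open>n\<close> is at least 3. This is exactly what
  puts \<open>n\<^sup>2 - 4\<close> strictly above \<open>(n - 1)\<^sup>2\<close>.\<close>

lemma nonsquare_disc_fixed_form:
  assumes "0 \<in> set w" "\<exists>l\<in>set w. l \<noteq> 0"
  shows "nonsquare_disc (fixed_form w)"
proof -
  obtain p r s t where w: "word_mat w = (p, r, s, t)" by (cases "word_mat w") auto
  note props = word_mat_props[OF w]
  have "r * s \<ge> 1" using props assms mult_mono[of 1 r 1 s] by auto
  with props have pt: "p * t \<ge> 2" by linarith
  have "p + t \<ge> 3"
  proof (rule ccontr)
    assume "\<not> p + t \<ge> 3"
    with props have "p = 1" "t = 1" by auto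
    with pt show False by simp
  qed
  define n where "n = p + t"
  have n: "n \<ge> 3" using \<open>p + t \<ge> 3\<close> n_def by simp
  have "disc (fixed_form w) = (t - p)\<^sup>2 + 4 * (r * s)"
    by (simp add: fixed_form_def w disc_def)
  also have "\<dots> = n\<^sup>2 - 4 * (p * t - r * s)"
    by (simp add: n_def power2_eq_square algebra_simps)
  also have "\<dots> = n\<^sup>2 - 4" using props by simp
  finally have D: "disc (fixed_form w) = n\<^sup>2 - 4" .
  have "n\<^sup>2 \<ge> 9" using power_mono[OF n, of 2] by simp
  moreover have "n\<^sup>2 - 4 \<noteq> m\<^sup>2" for m
  proof
    assume m: "n\<^sup>2 - 4 = m\<^sup>2"
    then have "\<bar>m\<bar>\<^sup>2 < n\<^sup>2" by simp
    then have "\<bar>m\<bar> < n" by (rule power2_less_imp_less) (use n in linarith)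
    then have "\<bar>m\<bar>\<^sup>2 \<le> (n - 1)\<^sup>2" by (intro power_mono) auto
    then show False using m n by (simp add: power2_eq_square algebra_simps)
  qed
  ultimately show ?thesis using D by (simp add: nonsquare_disc_def)
qed

text \<open>For a Gram matrix Q, invariance M^T Q M = Q is quadratic in the entries of M, but M^T Q
  = Q M^(-1) is linear. Its first column gives both proportions.\<close>

lemma fixed_simple_form_proportional:
  assumes "w \<noteq> []" "word_act w (a, b, c) = (a, b, c)" "is_simple (a, b, c)"
    and "word_mat w = (p, r, s, t)"
  shows "s > 0" "s * b = a * (t - p)" "s * c = - (a * r)"
proof -
  note props = word_mat_props[OF assms(4)]
  have det: "p * t - r * s = 1" using props by auto
  from assms(2) have
    e: "a * p\<^sup>2 + b * p * s + c * s\<^sup>2 = a"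
      "2 * a * p * r + b * (p * t + r * s) + 2 * c * s * t = b"
      "a * r\<^sup>2 + b * r * t + c * t\<^sup>2 = c"
    unfolding word_act_eq_substitution[OF assms(4)] by auto
  \<comment> \<open>The multipliers \<open>t\<close> and \<open>- s\<close>, here and below, form
    the first column of M^(-1); the combination undoes the right factor M up to the
    determinant.\<close>
  have "t * (2 * a * p * r + b * (p * t + r * s) + 2 * c * s * t)
      - 2 * s * (a * r\<^sup>2 + b * r * t + c * t\<^sup>2) = (2 * a * r + b * t) * (p * t - r * s)"
    by (simp add: power2_eq_square algebra_simps)
  then have "t * b - 2 * s * c = (2 * a * r + b * t) * 1" unfolding e det .
  then have "2 * (s * c) = 2 * - (a * r)" by algebra
  then show 1: "s * c = - (a * r)" by linarith
  have "2 * t * (a * p\<^sup>2 + b * p * s + c * s\<^sup>2)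
      - s * (2 * a * p * r + b * (p * t + r * s) + 2 * c * s * t) = (2 * a * p + b * s) * (p * t - r * s)"
    by (simp add: power2_eq_square algebra_simps)
  then have "2 * t * a - s * b = (2 * a * p + b * s) * 1" unfolding e det .
  then have "2 * (s * b) = 2 * (a * (t - p))" by algebra
  then show "s * b = a * (t - p)" by linarith
  have "s \<noteq> 0"
  \<comment> \<open>If \<open>s\<close> vanished, so would \<open>r\<close>, since
    \<open>a > 0\<close>; but any letter of the nonempty word makes one of the two positive.\<close>
  proof
    assume "s = 0"
    then have "r = 0" using 1 assms(3) by auto
    obtain l where "l \<in> set w" using assms(1) by (cases w) auto
    then have "0 \<in> set w \<or> (\<exists>l\<in>set w. l \<noteq> 0)" by (cases "l = 0") auto
    with props \<open>s = 0\<close> \<open>r = 0\<close> show False by linarith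
  qed
  with props show "s > 0" by auto
qed

lemma fixed_simple_forms_proportional:
  assumes "w \<noteq> []" "word_act w (a, b, c) = (a, b, c)" "is_simple (a, b, c)"
    "word_act w (a', b', c') = (a', b', c')" "is_simple (a', b', c')"
  shows "a' * b = a * b'" "a' * c = a * c'"
proof -
  obtain p r s t where w: "word_mat w = (p, r, s, t)" by (cases "word_mat w") auto
  note 1 = fixed_simple_form_proportional[OF assms(1-3) w]
  note 2 = fixed_simple_form_proportional[OF assms(1,4,5) w]
  have "s * (a' * b) = s * (a * b')" using 1(2) 2(2) by algebra
  then show "a' * b = a * b'" using 1(1) by simp
  have "s * (a' * c) = s * (a * c')" using 1(3) 2(3) by algebra
  then show "a' * c = a * c'" using 1(1) by simp
qed

section \<open>Recovering a simple form from its river word\<close>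

lemma word_act_form_word:
  assumes "is_simple q" "nonsquare_disc q"
  shows "word_act (form_word q) q = q"
proof -
  have "word_act (map (\<lambda>i. river_turn ((form_next ^^ i) q)) [0..<k]) q = (form_next ^^ k) q" for k
    by (induction k) (auto simp: word_act_append form_next_def)
  then show ?thesis using form_period(2)[OF assms] by (simp add: form_word_def)
qed

lemma form_word_nonempty:
  assumes "is_simple q" "nonsquare_disc q"
  shows "form_word q \<noteq> []"
  using form_period(1)[OF assms] by (metis length_form_word list.size(3) not_one_le_zero)

text \<open>Both forms are fixed by the same nonempty word, hence proportional; equal discriminants
  force the factor to be 1 up to sign, and \<open>a, a' > 0\<close> settles the sign.\<close>

lemma form_word_inject_disc:
  assumes "is_simple q" "nonsquare_disc q" "is_simple q'" "nonsquare_disc q'"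
    and "form_word q = form_word q'" "disc q = disc q'"
  shows "q = q'"
proof -
  obtain a b c a' b' c' where q: "q = (a, b, c)" "q' = (a', b', c')" by (cases q; cases q')
  have pos: "a > 0" "a' > 0" using assms q by auto
  have q': "word_act (form_word q) q' = q'" using word_act_form_word[OF assms(3,4)] assms(5) by simp
  have ratio: "a' * b = a * b'" "a' * c = a * c'"
    using fixed_simple_forms_proportional[OF form_word_nonempty[OF assms(1,2)]]
      word_act_form_word[OF assms(1,2)] q' assms(1,3) unfolding q by blast+
  have "a'\<^sup>2 * disc q = a\<^sup>2 * disc q'"
    using ratio unfolding q disc_def by (simp add: power2_eq_square) algebra
  then have "a'\<^sup>2 = a\<^sup>2" using assms by (simp add: nonsquare_disc_def)
  then have "a = a'" using pos by simp
  with ratio pos show ?thesis using q by auto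
qed

text \<open>Proportionality makes \<open>a\<close> divide \<open>a'\<close> times each coefficient
  of the first form, hence \<open>a'\<close> times their gcd, which is \<open>a'\<close>. By
  symmetry \<open>a'\<close> divides \<open>a\<close>.\<close>

lemma form_word_inject_primitive:
  assumes "is_simple q" "nonsquare_disc q" "is_simple q'" "nonsquare_disc q'"
    and "form_word q = form_word q'" "primitive_form q" "primitive_form q'"
  shows "q = q'"
proof -
  obtain a b c a' b' c' where q: "q = (a, b, c)" "q' = (a', b', c')" by (cases q; cases q')
  have pos: "a > 0" "a' > 0" using assms q by auto
  have q': "word_act (form_word q) q' = q'" using word_act_form_word[OF assms(3,4)] assms(5) by simp
  have ratio: "a' * b = a * b'" "a' * c = a * c'"
    using fixed_simple_forms_proportional[OF form_word_nonempty[OF assms(1,2)]]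
      word_act_form_word[OF assms(1,2)] q' assms(1,3) unfolding q by blast+
  have dvd: "x dvd x'" if "x' > 0" "x' * y = x * y'" "x' * z = x * z'" "primitive_form (x, y, z)"
    for x y z x' y' z' :: int
  proof -
    have "is_unit (gcd x (gcd y z))"
      using that(4)[unfolded primitive_form_def, rule_format, of "gcd x (gcd y z)"]
      by (auto intro: dvd_trans[OF gcd_dvd2])
    then have g: "gcd x (gcd y z) = 1" by simp
    have "x dvd gcd (x' * x) (gcd (x' * y) (x' * z))" using that(2,3) by simp
    also have "gcd (x' * x) (gcd (x' * y) (x' * z)) = x' * gcd x (gcd y z)"
      using that(1) by (simp add: gcd_mult_left)
    finally show ?thesis using g by simp
  qed
  have "a dvd a'" "a' dvd a"
    using dvd[where x = a and x' = a' and y = b and y' = b' and z = c and z' = c']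
      dvd[where x = a' and x' = a and y = b' and y' = b and z = c' and z' = c]
      ratio pos assms(6,7) q by auto
  then have "a = a'" using pos by (intro zdvd_antisym_nonneg) auto
  with ratio pos show ?thesis using q by auto
qed

text \<open>If the word is a power of \<open>v\<close>, rotating it by the length of
  \<open>v\<close> does not change it. The form that many steps later then has the same word and
  discriminant, so it is the starting form, and the walk would have stopped earlier.\<close>

lemma form_word_nonrepeating:
  assumes "is_simple q" "nonsquare_disc q"
  shows "\<not> repeating (form_word q)"
proof
  assume "repeating (form_word q)"
  then obtain v k where k: "k \<ge> 2" "length v < form_period q"
    and w: "form_word q = concat (replicate k v)"
    by (auto simp: repeating_def)
  obtain k' where k': "k = Suc k'" using k by (cases k) auto
  have "v \<noteq> []" using form_word_nonempty[OF assms] w by auto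
  define q' where "q' = (form_next ^^ length v) q"
  have "form_word q' = rotate (length v) (concat (replicate k v))"
    using form_word_funpow[OF assms] w by (simp add: q'_def)
  also have "\<dots> = concat (replicate k' v @ [v])" by (simp add: k' rotate_append)
  also have "\<dots> = concat (replicate k v)" by (simp only: k' replicate_append_same replicate_Suc)
  finally have "form_word q' = form_word q" using w by simp
  moreover have "is_simple q'" "nonsquare_disc q'" "disc q' = disc q"
    using is_simple_funpow_form_next[OF assms] assms(2) nonsquare_disc_cong[of q q']
    by (auto simp: q'_def)
  ultimately have "q' = q" using form_word_inject_disc assms by blast
  then have "form_period q \<le> length v"
    using \<open>v \<noteq> []\<close> by (intro form_period_le) (auto simp: q'_def Suc_le_eq)
  with k show False by simp
qed

lemma form_period_ge_2:
  assumes "is_simple q" "nonsquare_disc q"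
  shows "form_period q \<ge> 2"
proof (rule ccontr)
  assume "\<not> form_period q \<ge> 2"
  then have "form_period q = 1" using form_period(1)[OF assms] by simp
  then have "form_next q = q" using form_period(2)[OF assms] by simp
  then show False using assms by (cases q) (auto simp: form_next_def split: if_splits)
qed

section \<open>Every non-repeating binary word arises\<close>

lemma concat_replicate_periodic:
  assumes "\<And>i. h (i + m) = h i"
  shows "map h [0..<k * m] = concat (replicate k (map h [0..<m]))"
proof (induction k)
  case (Suc k)
  have per: "h (i + j * m) = h i" for i j
    by (induction j) (auto simp: assms add.assoc[symmetric] add.commute[of m])
  have "map h [0..<Suc k * m] = map h [0..<k * m] @ map h [k * m..<k * m + m]"
    using upt_add_eq_append[of 0 "k * m" m] by (simp add: add.commute)
  also have "map h [k * m..<k * m + m] = map h [0..<m]"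
    by (simp add: add.commute[of _ m] per flip: map_add_upt)
  also have "map h [0..<k * m] = concat (replicate k (map h [0..<m]))" by (rule Suc.IH)
  also have "\<dots> @ map h [0..<m] = concat (replicate (Suc k) (map h [0..<m]))"
    by (simp flip: replicate_append_same)
  finally show ?case .
qed simp

fun form_scale :: "int \<Rightarrow> int \<times> int \<times> int \<Rightarrow> int \<times> int \<times> int" where
  "form_scale g (a, b, c) = (g * a, g * b, g * c)"

lemma fstep_form_scale: "fstep l (form_scale g q) = form_scale g (fstep l q)"
  by (cases q) (simp add: algebra_simps)

lemma word_act_form_scale: "word_act w (form_scale g q) = form_scale g (word_act w q)"
  by (induction w arbitrary: q) (auto simp: fstep_form_scale)

lemma is_simple_form_scale: "g > 0 \<Longrightarrow> is_simple (form_scale g q) = is_simple q"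
  by (cases q) (auto simp: zero_less_mult_iff mult_less_0_iff)

lemma form_scale_inject: "g \<noteq> 0 \<Longrightarrow> form_scale g q = form_scale g q' \<Longrightarrow> q = q'"
  by (cases q; cases q') auto

lemma disc_form_scale: "disc (form_scale g q) = g\<^sup>2 * disc q"
  by (cases q) (simp add: disc_def power2_eq_square algebra_simps)

lemma nonsquare_disc_form_scale: "nonsquare_disc (form_scale g q) \<Longrightarrow> nonsquare_disc q"
  unfolding nonsquare_disc_def disc_form_scale
  by (metis zero_less_mult_pos zero_le_power2 mult_nonneg_nonpos2 linorder_not_le power_mult_distrib
      mult_nonneg_nonpos)

lemma obtain_primitive_form:
  assumes "is_simple q"
  obtains g q' where "g > 0" "q = form_scale g q'" "primitive_form q'"
proof -
  obtain a b c where q: "q = (a, b, c)" by (cases q)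
  define g where "g = gcd a (gcd b c)"
  have g: "g > 0" using assms q by (auto simp: g_def)
  have "g dvd a" "g dvd b" "g dvd c" unfolding g_def by (auto intro: dvd_trans[OF gcd_dvd2])
  then obtain a' b' c' where abc: "a = g * a'" "b = g * b'" "c = g * c'" by (auto elim!: dvdE)
  have "primitive_form (a', b', c')"
    unfolding primitive_form_def
  proof (intro allI impI)
    fix h assume "form_dvd h (a', b', c')"
    then have "g * h dvd a" "g * h dvd b" "g * h dvd c" using abc by auto
    then have "g * h dvd g" unfolding g_def by (intro gcd_greatest)
    then show "is_unit h" using g by simp
  qed
  then show ?thesis using that[of g "(a', b', c')"] g abc q by auto
qed

text \<open>A step stays on the river in only one way: either letter puts \<open>a + b + c\<close>
  into a place whose sign is prescribed.\<close>

lemma river_turn_eq: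
  assumes "is_simple (fstep l q)" "l \<in> {0, 1}"
  shows "river_turn q = l"
  using assms by (cases q) (auto split: if_splits)

lemma nonrepeating_letters:
  assumes "w \<in> lists {0, 1}" "length w \<ge> 2" "\<not> repeating w"
  shows "0 \<in> set w" "\<exists>l\<in>set w. l \<noteq> (0::nat)"
proof -
  have *: "\<exists>l\<in>set w. l \<noteq> x" for x
  proof (rule ccontr)
    assume "\<not> (\<exists>l\<in>set w. l \<noteq> x)"
    then have "w = replicate (length w) x" by (metis replicate_length_same)
    moreover have "concat (replicate n [x]) = replicate n x" for n by (induction n) auto
    ultimately have "repeating w" unfolding repeating_def
      using assms(2) by (intro exI[of _ "[x]"] exI[of _ "length w"]) auto
    with assms(3) show False by simp
  qed
  show "\<exists>l\<in>set w. l \<noteq> 0" by (rule *)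
  show "0 \<in> set w" using *[of 1] assms(1) by (auto simp: in_lists_conv_set)
qed

lemma form_word_surj:
  assumes w: "w \<in> lists {0, 1}" "length w \<ge> 2" "\<not> repeating w"
  obtains q where "is_simple q" "nonsquare_disc q" "primitive_form q" "form_word q = w"
proof -
  note letters = nonrepeating_letters[OF w]
  obtain g q where g: "g > 0" and fix_q: "fixed_form w = form_scale g q" and prim: "primitive_form q"
    using obtain_primitive_form[OF is_simple_fixed_form[OF letters]] .
  have q: "is_simple q" "nonsquare_disc q"
    using is_simple_fixed_form[OF letters] nonsquare_disc_fixed_form[OF letters] fix_q g
    by (auto simp: is_simple_form_scale dest: nonsquare_disc_form_scale)
  let ?n = "length w"
  \<comment> \<open>After the prefix \<open>u\<close> the form is, up to the factor
    \<open>g\<close>, the fixed form of the rotation \<open>x @ u\<close>, which still contains both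
    letters.\<close>
  have simp: "is_simple (word_act u q)" if "w = u @ x" for u x
  proof -
    have "form_scale g (word_act u q) = fixed_form (x @ u)"
      using word_act_fixed_form[of u x] that fix_q by (simp add: word_act_form_scale)
    moreover have "is_simple (fixed_form (x @ u))"
      using letters that by (intro is_simple_fixed_form) auto
    ultimately show ?thesis using is_simple_form_scale[OF g] by metis
  qed
  have "form_scale g (word_act w q) = form_scale g q"
    using word_act_fixed_form[of w "[]"] fix_q by (simp add: word_act_form_scale)
  then have fixed: "word_act w q = q" using g form_scale_inject[of g] by simp
  have turn: "river_turn (word_act (take i w) q) = w ! i" if "i < ?n" for i
  proof (rule river_turn_eq)
    have "word_act (take (Suc i) w) q = fstep (w ! i) (word_act (take i w) q)"
      using that by (simp add: take_Suc_conv_app_nth word_act_append)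
    then show "is_simple (fstep (w ! i) (word_act (take i w) q))"
      using simp[of "take (Suc i) w" "drop (Suc i) w"] by simp
    show "w ! i \<in> {0, 1}" using w(1) that by (auto simp: in_lists_conv_set)
  qed
  have iter: "(form_next ^^ i) q = word_act (take i w) q" if "i \<le> ?n" for i
    using that
  proof (induction i)
    case (Suc i)
    then show ?case
      by (simp add: form_next_def turn take_Suc_conv_app_nth word_act_append)
  qed simp
  let ?h = "\<lambda>i. river_turn ((form_next ^^ i) q)"
  let ?m = "form_period q"
  have w_eq: "w = map ?h [0..<?n]"
    by (rule nth_equalityI) (auto simp: iter turn)
  have "(form_next ^^ ?n) q = q" using iter[of ?n] fixed by simp
  \<comment> \<open>So far the walk spells \<open>w\<close> but may close up before reaching its
    end. Then \<open>w\<close> would be a proper power of the period word, which non-repetition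
    excludes.\<close>
  then have "?m dvd ?n" using form_period_dvd q by blast
  then obtain k where k: "?n = k * ?m" by (metis dvdE mult.commute)
  have "?h (i + ?m) = ?h i" for i using form_period(2)[OF q] by (simp add: funpow_add)
  then have "map ?h [0..<?n] = concat (replicate k (form_word q))"
    unfolding k form_word_def by (rule concat_replicate_periodic)
  with w_eq have conc: "w = concat (replicate k (form_word q))" by simp
  have "k < 2"
  proof (rule ccontr)
    assume "\<not> k < 2"
    moreover have "?m < ?n"
    proof -
      have "?m * 2 \<le> ?n" using \<open>\<not> k < 2\<close> k by simp
      with form_period(1)[OF q] show ?thesis by linarith
    qed
    ultimately have "repeating w" unfolding repeating_def
      using conc by (intro exI[of _ "form_word q"] exI[of _ k]) auto
    with w show False by simp
  qed
  moreover have "k \<noteq> 0"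
  proof
    assume "k = 0"
    with k w(2) show False by simp
  qed
  ultimately have "k = 1" by simp
  with conc have "form_word q = w" by simp
  with q prim show ?thesis using that by blast
qed

subsection \<open>Walks in a plane cubic tree\<close>

text \<open>The equational part of \<open>plane_cubic_tree\<close>. Unlike connectedness it passes
  to products, which is where walks are compared later.\<close>

definition dart_system :: "'d topograph \<Rightarrow> bool" where
  "dart_system T \<longleftrightarrow>
     (\<forall>d\<in>darts T. flip T d \<in> darts T \<and> flip T (flip T d) = d \<and>
        turn T d \<in> darts T \<and> turn T (turn T (turn T d)) = d)"

definition dart_step :: "'d topograph \<Rightarrow> ('d \<times> 'd) set" where
  "dart_step T = {(x, y). x \<in> darts T \<and> (y = flip T x \<or> y = turn T x)}"

lemma dart_systemD:
  assumes "dart_system T" "d \<in> darts T"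
  shows "flip T d \<in> darts T" "flip T (flip T d) = d"
    "turn T d \<in> darts T" "turn T (turn T (turn T d)) = d"
  using assms by (auto simp: dart_system_def)

lemma dart_system_tree: "plane_cubic_tree T \<Longrightarrow> dart_system T"
  by (auto simp: plane_cubic_tree_def dart_system_def)

lemma dart_system_topograph: "is_topograph T \<Longrightarrow> dart_system T"
  by (auto simp: is_topograph_def dart_system_tree)

lemma dart_connected:
  assumes "plane_cubic_tree T" "d \<in> darts T" "e \<in> darts T"
  shows "(d, e) \<in> (dart_step T)\<^sup>*"
  using assms by (auto simp: plane_cubic_tree_def dart_step_def)

lemma dart_step_sym:
  assumes "dart_system T" "(x, y) \<in> (dart_step T)\<^sup>*"
  shows "(y, x) \<in> (dart_step T)\<^sup>*"
  using assms(2)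
proof induction
  case (step y z)
  then have y: "y \<in> darts T" by (auto simp: dart_step_def)
  note D = dart_systemD[OF assms(1)]
  have "(z, y) \<in> (dart_step T)\<^sup>*"
  proof (cases "z = flip T y")
    case True
    then have "(z, y) \<in> dart_step T" using D[OF y] by (auto simp: dart_step_def)
    then show ?thesis by blast
  next
    case False
    then have z: "z = turn T y" using step by (auto simp: dart_step_def)
    then have "(z, turn T z) \<in> dart_step T" "(turn T z, y) \<in> dart_step T"
      using D(1,3,4)[OF y] D(3)[of "turn T y"] by (auto simp: dart_step_def)
    then show ?thesis by (meson converse_rtrancl_into_rtrancl r_into_rtrancl)
  qed
  with step.IH show ?case by (rule rtrancl_trans[rotated])
qed auto

lemma dart_step_darts:
  assumes "dart_system T" "d \<in> darts T" "(d, e) \<in> (dart_step T)\<^sup>*"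
  shows "e \<in> darts T"
  using assms(3) by induction (use assms dart_systemD in \<open>auto simp: dart_step_def\<close>)

text \<open>Flips and turns cancel to a walk without backtracking, at the cost of choosing the
  direction of the first and last edge. Stated for \<open>dart_system\<close> so that it applies to
  a product of two trees.\<close>

lemma walk_normal_form:
  assumes T: "dart_system T" and d: "d \<in> darts T" and "(d, e) \<in> (dart_step T)\<^sup>*"
  shows "\<exists>x\<in>{d, flip T d}. (x, e) \<in> (walk_rel T)\<^sup>* \<or> (x, flip T e) \<in> (walk_rel T)\<^sup>*"
  using assms(3)
proof induction
  case (step y z)
  note D = dart_systemD[OF T]
  have y: "y \<in> darts T" using step by (auto simp: dart_step_def)
  from step.IH obtain x where x: "x \<in> {d, flip T d}"
    and xy: "(x, y) \<in> (walk_rel T)\<^sup>* \<or> (x, flip T y) \<in> (walk_rel T)\<^sup>*" by blast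
  have xd: "x \<in> darts T" "flip T x \<in> {d, flip T d}" "flip T (flip T x) = x"
    using x d D[OF d] by auto
  show ?case
  proof (cases "z = flip T y")
    case True
    then show ?thesis using x xy D[OF y] by auto
  next
    case False
    then have z: "z = turn T y" using step by (auto simp: dart_step_def)
    show ?thesis
    proof (cases "(x, flip T y) \<in> (walk_rel T)\<^sup>*")
      case True
      moreover have "(flip T y, z) \<in> walk_rel T"
        using D[OF y] z by (auto simp: walk_rel_def right_turn_def)
      ultimately show ?thesis using x by (meson rtrancl_into_rtrancl)
    next
      case False
      then have "(x, y) \<in> (walk_rel T)\<^sup>*" using xy by blast
      then show ?thesis
      proof (cases rule: rtranclE)
        case base
        then have "(flip T x, z) \<in> walk_rel T"
          using z D[OF xd(1)] xd by (auto simp: walk_rel_def right_turn_def)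
        then show ?thesis using xd(2) by blast
      next
        case (step v)
        then have v: "v \<in> darts T" by (auto simp: walk_rel_def)
        note Dv = D[OF v] D[OF D(1)[OF v]]
        show ?thesis
        \<comment> \<open>Rotating on from a left turn points back along \<open>v\<close>, so the
          last step is cancelled; rotating on from a right turn gives the left turn from the same
          \<open>v\<close>.\<close>
        proof (cases "y = left_turn T v")
          case True
          then have "flip T z = v" using z Dv by (simp add: left_turn_def)
          with step x show ?thesis by blast
        next
          case False
          then have "z = left_turn T v"
            using step z by (auto simp: walk_rel_def left_turn_def right_turn_def)
          then have "(v, z) \<in> walk_rel T" using v by (auto simp: walk_rel_def)
          with step(1) x show ?thesis by (meson rtrancl_into_rtrancl)
        qed
      qed
    qed
  qed
qed auto

text \<open>A shortest walk reversing its direction would start and end with the same edge, and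
  removing this edge at both ends leaves a shorter one.\<close>

lemma walk_not_reversing:
  assumes T: "plane_cubic_tree T" and "x \<in> darts T"
  shows "(x, flip T x) \<notin> (walk_rel T)\<^sup>*"
proof -
  note D = dart_systemD[OF dart_system_tree[OF T]]
  have irrefl: "flip T d \<noteq> d" "turn T d \<noteq> d" if "d \<in> darts T" for d
    using T that by (auto simp: plane_cubic_tree_def)
  have irrefl2: "turn T (turn T d) \<noteq> d" if "d \<in> darts T" for d
    using irrefl(2)[OF that] D(4)[OF that] by metis
  have "(x, flip T x) \<notin> walk_rel T ^^ n" if "x \<in> darts T" for n x
    using that
  proof (induction n arbitrary: x rule: less_induct)
    case (less n)
    note Dx = D[OF less.prems] D[OF D(1)[OF less.prems]]
    consider "n = 0" | "n = 1" | m where "n = Suc (Suc m)"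
      by (metis One_nat_def not0_implies_Suc)
    then show ?case
    proof cases
      case 1
      then show ?thesis using irrefl(1)[OF less.prems] by auto
    next
      case 2
      then show ?thesis using irrefl(2)[OF Dx(1)] irrefl2[OF Dx(1)]
        by (auto simp: walk_rel_def left_turn_def right_turn_def)
    next
      case 3
      show ?thesis
      proof
        assume "(x, flip T x) \<in> walk_rel T ^^ n"
        then have "(x, flip T x) \<in> walk_rel T ^^ Suc (Suc m)" by (simp only: 3)
        then obtain x1 where x1: "(x, x1) \<in> walk_rel T" "(x1, flip T x) \<in> walk_rel T ^^ Suc m"
          by (blast dest: relpow_Suc_D2)
        then obtain y where y: "(x1, y) \<in> walk_rel T ^^ m" "(y, flip T x) \<in> walk_rel T"
          by (blast elim: relpow_Suc_E)
        have yd: "y \<in> darts T" using y by (auto simp: walk_rel_def)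
        note Dy = D[OF yd] D[OF D(1)[OF yd]]
        show False
        proof (cases "flip T y = x1")
          case True
          then have "(x1, flip T x1) \<in> walk_rel T ^^ m" "x1 \<in> darts T" using y Dy by auto
          moreover have "m < n" using 3 by simp
          ultimately show False using less.IH by blast
        next
          case False
          have "flip T y = turn T (turn T (flip T x)) \<or> flip T y = turn T (flip T x)"
            using y(2) Dy by (auto simp: walk_rel_def left_turn_def right_turn_def)
          moreover have "x1 = turn T (turn T (flip T x)) \<or> x1 = turn T (flip T x)"
            using x1(1) by (auto simp: walk_rel_def left_turn_def right_turn_def)
          \<comment> \<open>\<open>flip T y\<close> and \<open>x1\<close> are now distinct darts
            leaving the head of \<open>x\<close>, so arriving by \<open>y\<close> one may continue
            with \<open>x1\<close>, closing a circuit.\<close>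
          ultimately have "(y, x1) \<in> walk_rel T" using False Dx yd
            by (auto simp: walk_rel_def left_turn_def right_turn_def)
          moreover have "(x1, y) \<in> (walk_rel T)\<^sup>*" using y(1) by (rule relpow_imp_rtrancl)
          ultimately have "(y, y) \<in> (walk_rel T)\<^sup>+" by (rule rtrancl_into_trancl2)
          then show False using T by (auto simp: plane_cubic_tree_def acyclic_def)
        qed
      qed
    qed
  qed
  then show ?thesis using assms(2) by (meson rtrancl_imp_relpow)
qed

subsection \<open>A topograph is determined by one configuration\<close>

definition prod_darts :: "'d topograph \<Rightarrow> 'e topograph \<Rightarrow> ('d \<times> 'e) topograph" where
  "prod_darts T T' = \<lparr>darts = darts T \<times> darts T', flip = map_prod (flip T) (flip T'),
     turn = map_prod (turn T) (turn T'), lab = \<lambda>_. 0\<rparr>"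

lemma prod_darts_simps [simp]:
  "darts (prod_darts T T') = darts T \<times> darts T'"
  "flip (prod_darts T T') = map_prod (flip T) (flip T')"
  "turn (prod_darts T T') = map_prod (turn T) (turn T')"
  by (auto simp: prod_darts_def)

text \<open>The graph of the isomorphism taking \<open>d\<close> to \<open>d'\<close> is the orbit of \<open>(d, d')\<close>.\<close>

definition joint_orbit :: "'d topograph \<Rightarrow> 'e topograph \<Rightarrow> 'd \<Rightarrow> 'e \<Rightarrow> ('d \<times> 'e) set" where
  "joint_orbit T T' d d' = {p. ((d, d'), p) \<in> (dart_step (prod_darts T T'))\<^sup>*}"

lemma dart_system_prod:
  "dart_system T \<Longrightarrow> dart_system T' \<Longrightarrow> dart_system (prod_darts T T')"
  by (auto simp: dart_system_def)

lemma walk_rel_prod_fst: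
  assumes "(p, p') \<in> (walk_rel (prod_darts T T'))\<^sup>*"
  shows "p = p' \<or> (fst p, fst p') \<in> (walk_rel T)\<^sup>+"
  using assms
proof induction
  case (step y z)
  then have "(fst y, fst z) \<in> walk_rel T"
    by (auto simp: walk_rel_def left_turn_def right_turn_def)
  with step.IH show ?case by (auto intro: trancl_into_trancl)
qed auto

lemma joint_orbit_refl: "(d, d') \<in> joint_orbit T T' d d'"
  by (simp add: joint_orbit_def)

lemma joint_orbit_step:
  assumes "(x, y) \<in> joint_orbit T T' d d'" "x \<in> darts T" "y \<in> darts T'"
  shows "(flip T x, flip T' y) \<in> joint_orbit T T' d d'"
    "(turn T x, turn T' y) \<in> joint_orbit T T' d d'"
  using assms unfolding joint_orbit_def
  by (auto elim!: rtrancl_into_rtrancl simp: dart_step_def)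

lemma joint_orbit_induct [consumes 1, case_names refl flip turn]:
  assumes "(x, y) \<in> joint_orbit T T' d d'"
    and "P d d'"
    and "\<And>x y. (x, y) \<in> joint_orbit T T' d d' \<Longrightarrow> x \<in> darts T \<Longrightarrow> y \<in> darts T' \<Longrightarrow> P x y \<Longrightarrow>
      P (flip T x) (flip T' y)"
    and "\<And>x y. (x, y) \<in> joint_orbit T T' d d' \<Longrightarrow> x \<in> darts T \<Longrightarrow> y \<in> darts T' \<Longrightarrow> P x y \<Longrightarrow>
      P (turn T x) (turn T' y)"
  shows "P x y"
proof -
  have "((d, d'), (x, y)) \<in> (dart_step (prod_darts T T'))\<^sup>*"
    using assms(1) by (simp add: joint_orbit_def)
  then show ?thesis
  proof (induction "(x, y)" arbitrary: x y rule: rtrancl_induct)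
    case base
    then show ?case using assms(2) by simp
  next
    case (step p)
    obtain v w where p: "p = (v, w)" by (cases p)
    have "(v, w) \<in> joint_orbit T T' d d'" using step p by (simp add: joint_orbit_def)
    moreover have "P v w" using step p by simp
    ultimately show ?case using step(2) p assms(3,4) by (auto simp: dart_step_def)
  qed
qed

lemma joint_orbit_darts:
  assumes "dart_system T" "dart_system T'" "d \<in> darts T" "d' \<in> darts T'"
    "(x, y) \<in> joint_orbit T T' d d'"
  shows "x \<in> darts T" "y \<in> darts T'"
  using dart_step_darts[OF dart_system_prod[OF assms(1,2)], of "(d, d')" "(x, y)"] assms
  by (auto simp: joint_orbit_def)

lemma joint_orbit_swap:
  assumes "dart_system T" "dart_system T'" "d \<in> darts T" "d' \<in> darts T'"
    "(x, y) \<in> joint_orbit T T' d d'"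
  shows "(y, x) \<in> joint_orbit T' T d' d"
  using assms(5)
proof (induction rule: joint_orbit_induct)
  case refl
  show ?case by (rule joint_orbit_refl)
qed (auto intro: joint_orbit_step)

lemma joint_orbit_total:
  assumes T: "plane_cubic_tree T" "plane_cubic_tree T'" and d: "d \<in> darts T" "d' \<in> darts T'"
    and x: "x \<in> darts T"
  shows "\<exists>y. (x, y) \<in> joint_orbit T T' d d'"
  using dart_connected[OF T(1) d(1) x]
proof induction
  case base
  show ?case using joint_orbit_refl by (rule exI)
next
  case (step x z)
  then obtain y where y: "(x, y) \<in> joint_orbit T T' d d'" by blast
  with joint_orbit_darts[OF dart_system_tree[OF T(1)] dart_system_tree[OF T(2)] d y] step(2)
  show ?case using joint_orbit_step[OF y] by (auto simp: dart_step_def)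
qed

text \<open>A path in the orbit from \<open>(x, y)\<close> to \<open>(x, y')\<close> is normalized
  in the product and projected to \<open>T\<close>. There it closes up or reverses direction, both
  impossible for a walk of positive length in a tree; so it is trivial, already in the
  product.\<close>

lemma joint_orbit_functional:
  assumes T: "plane_cubic_tree T" "dart_system T'" and d: "d \<in> darts T" "d' \<in> darts T'"
    and xy: "(x, y) \<in> joint_orbit T T' d d'" and xy': "(x, y') \<in> joint_orbit T T' d d'"
  shows "y = y'"
proof -
  let ?P = "prod_darts T T'"
  have T1: "dart_system T" using T(1) by (rule dart_system_tree)
  have P: "dart_system ?P" using T1 T(2) by (rule dart_system_prod)
  note D = dart_systemD[OF T1] dart_systemD[OF T(2)]
  have mem: "x \<in> darts T" "y \<in> darts T'" "y' \<in> darts T'"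
    using joint_orbit_darts[OF T1 T(2) d xy] joint_orbit_darts[OF T1 T(2) d xy'] by auto
  have "((x, y), (x, y')) \<in> (dart_step ?P)\<^sup>*"
    using dart_step_sym[OF P, of "(d, d')" "(x, y)"] xy xy' unfolding joint_orbit_def
    by (auto intro: rtrancl_trans)
  then obtain p where p: "p \<in> {(x, y), (flip T x, flip T' y)}"
    "(p, (x, y')) \<in> (walk_rel ?P)\<^sup>* \<or> (p, (flip T x, flip T' y')) \<in> (walk_rel ?P)\<^sup>*"
    using walk_normal_form[OF P, of "(x, y)" "(x, y')"] mem by auto
  have acyc: "(v, v) \<notin> (walk_rel T)\<^sup>+" for v
    using T(1) by (auto simp: plane_cubic_tree_def acyclic_def)
  have rev: "(x, flip T x) \<notin> (walk_rel T)\<^sup>+" "(flip T x, x) \<notin> (walk_rel T)\<^sup>+"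
    "flip T x \<noteq> x"
    using walk_not_reversing[OF T(1), of x] walk_not_reversing[OF T(1), of "flip T x"] mem D
      trancl_into_rtrancl[of _ _ "walk_rel T"] by fastforce+
  have *: "q = q' \<or> (fst q, fst q') \<in> (walk_rel T)\<^sup>+" if "(q, q') \<in> (walk_rel ?P)\<^sup>*" for q q'
    using walk_rel_prod_fst[OF that] .
  have "y = y' \<or> flip T' y = flip T' y'"
    using p acyc rev by (auto dest!: *)
  then show ?thesis using D(6)[OF mem(2)] D(6)[OF mem(3)] by metis
qed

text \<open>\<open>form_flip\<close> and \<open>form_turn\<close> are the substitutions by the
  standard generators of PSL(2, Z), of orders 2 and 3; \<open>form_turn\<close> sends (x, y) to (x +
  y, - x).\<close>

fun form_flip :: "int \<times> int \<times> int \<Rightarrow> int \<times> int \<times> int" where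
  "form_flip (a, b, c) = (c, - b, a)"

fun form_turn :: "int \<times> int \<times> int \<Rightarrow> int \<times> int \<times> int" where
  "form_turn (a, b, c) = (a - b + c, 2 * a - b, a)"

lemma configuration_flip:
  assumes "is_topograph T" "d \<in> darts T"
  shows "configuration T (flip T d) = form_flip (configuration T d)"
proof -
  have "tail_lab T d + head_lab T d = 2 * (lab T d + lab T (flip T d))"
    using assms by (auto simp: is_topograph_def)
  then show ?thesis using dart_systemD[OF dart_system_topograph[OF assms(1)] assms(2)]
    by (simp add: configuration_def edge_lab_def tail_lab_def head_lab_def right_turn_def)
qed

lemma configuration_turn:
  assumes "is_topograph T" "d \<in> darts T"
  shows "configuration T (turn T d) = form_turn (configuration T d)"
proof -
  note D = dart_systemD[OF dart_system_topograph[OF assms(1)]]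
  note D1 = D[OF assms(2)]
  have left: "lab T (turn T (turn T (flip T e))) = lab T e" if "e \<in> darts T" for e
    using assms that by (auto simp: is_topograph_def left_turn_def)
  have "lab T (turn T (turn T d)) = lab T (flip T d)" using left[OF D1(1)] D1 by simp
  moreover have "lab T (flip T (turn T d)) = lab T d"
    using left[OF D(1)[OF D1(3)]] D[OF D1(3)] D1 by simp
  ultimately show ?thesis by (simp add: configuration_def edge_lab_def tail_lab_def)
qed

text \<open>The joint orbit is total and functional in both directions, hence the graph of a
  bijection. Labels agree along it because configurations change under flips and turns by the same
  maps in every topograph.\<close>

lemma topograph_iso_if_configuration_eq:
  assumes T: "is_topograph T" "is_topograph T'" and d: "d \<in> darts T" "d' \<in> darts T'"
    and conf: "configuration T d = configuration T' d'"
  shows "(T, T') \<in> topograph_iso"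
proof -
  have tree: "plane_cubic_tree T" "plane_cubic_tree T'" using T by (auto simp: is_topograph_def)
  note sys = dart_system_tree[OF tree(1)] dart_system_tree[OF tree(2)]
  let ?J = "joint_orbit T T' d d'"
  note swap = joint_orbit_swap[OF sys d]
  note mem = joint_orbit_darts[OF sys d]
  have fun1: "y = y'" if "(x, y) \<in> ?J" "(x, y') \<in> ?J" for x y y'
    using joint_orbit_functional[OF tree(1) sys(2) d that] .
  have fun2: "x = x'" if "(x, y) \<in> ?J" "(x', y) \<in> ?J" for x x' y
    using joint_orbit_functional[OF tree(2) sys(1) d(2,1) swap[OF that(1)] swap[OF that(2)]] .
  define f where "f x = (THE y. (x, y) \<in> ?J)" for x
  have f_eq: "f x = y" if "(x, y) \<in> ?J" for x y
    unfolding f_def using that fun1 by blast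
  have f: "(x, f x) \<in> ?J" if "x \<in> darts T" for x
    using joint_orbit_total[OF tree d that] f_eq by metis
  have "bij_betw f (darts T) (darts T')"
  proof (rule bij_betwI')
    fix x y assume "x \<in> darts T" "y \<in> darts T"
    then show "f x = f y \<longleftrightarrow> x = y" using f fun2 by metis
  next
    fix x assume "x \<in> darts T"
    then show "f x \<in> darts T'" using f mem by blast
  next
    fix y assume "y \<in> darts T'"
    then obtain x where "(y, x) \<in> joint_orbit T' T d' d"
      using joint_orbit_total[OF tree(2,1) d(2,1)] by blast
    then have "(x, y) \<in> ?J" by (rule joint_orbit_swap[OF sys(2,1) d(2,1)])
    then show "\<exists>x\<in>darts T. y = f x" using mem f_eq by metis
  qed
  moreover have "f (flip T x) = flip T' (f x)" "f (turn T x) = turn T' (f x)" if "x \<in> darts T" for x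
    using f_eq joint_orbit_step[OF f[OF that] that] mem[OF f[OF that]] by auto
  moreover have "lab T' (f x) = lab T x" if "x \<in> darts T" for x
  proof -
    have "configuration T x = configuration T' (f x)"
      using f[OF that]
      by (induction rule: joint_orbit_induct)
        (use conf configuration_flip[OF T(1)] configuration_flip[OF T(2)]
          configuration_turn[OF T(1)] configuration_turn[OF T(2)] in auto)
    then show ?thesis by (simp add: configuration_def)
  qed
  ultimately show ?thesis using T by (auto simp: topograph_iso_def)
qed

lemma configuration_invariant:
  assumes T: "is_topograph T" "d \<in> darts T" "e \<in> darts T" and P: "P (configuration T d)"
    and "\<And>q. P q \<Longrightarrow> P (form_flip q)" "\<And>q. P q \<Longrightarrow> P (form_turn q)"
  shows "P (configuration T e)"
proof -
  have "(d, e) \<in> (dart_step T)\<^sup>*" using T dart_connected by (auto simp: is_topograph_def)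
  then show ?thesis
  proof induction
    case (step x y)
    then have x: "x \<in> darts T" and y: "y = flip T x \<or> y = turn T x"
      by (auto simp: dart_step_def)
    from y show ?case
      using assms(5,6)[OF step.IH] configuration_flip[OF T(1) x] configuration_turn[OF T(1) x]
      by metis
  qed (rule P)
qed

lemma disc_configuration:
  assumes "is_topograph T" "d \<in> darts T" "e \<in> darts T"
  shows "disc (configuration T e) = disc (configuration T d)"
proof (rule configuration_invariant[OF assms])
  fix q assume "disc q = disc (configuration T d)"
  then show "disc (form_flip q) = disc (configuration T d)"
    "disc (form_turn q) = disc (configuration T d)"
    by (cases q; simp add: disc_def power2_eq_square algebra_simps)+
qed simp

text \<open>Dividing all three coefficients is preserved by flips and turns, so a common divisor of
  one configuration divides every region label; conversely edge labels are integer combinations of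
  region labels.\<close>

lemma primitive_iff_primitive_form:
  assumes "is_topograph T" "d \<in> darts T"
  shows "primitive T \<longleftrightarrow> primitive_form (configuration T d)"
proof
  assume prim: "primitive T"
  show "primitive_form (configuration T d)"
    unfolding primitive_form_def
  proof (intro allI impI)
    fix g assume g: "form_dvd g (configuration T d)"
    have "form_dvd g (configuration T e)" if "e \<in> darts T" for e
    proof (rule configuration_invariant[where P = "form_dvd g", OF assms that g])
      fix q assume "form_dvd g q"
      then show "form_dvd g (form_flip q)" "form_dvd g (form_turn q)"
        by (cases q; auto)+
    qed
    then have "g dvd Gcd (lab T ` darts T)"
      by (intro Gcd_greatest) (auto simp: configuration_def)
    then show "is_unit g" using prim by (simp add: primitive_def)
  qed
next
  assume prim: "primitive_form (configuration T d)"
  let ?g = "Gcd (lab T ` darts T)"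
  have "?g dvd lab T e" if "e \<in> darts T" for e using that by simp
  then have "form_dvd ?g (configuration T d)"
    using dart_systemD[OF dart_system_topograph[OF assms(1)] assms(2)] assms(2)
    by (simp add: configuration_def edge_lab_def tail_lab_def)
  then have "is_unit ?g" using prim unfolding primitive_form_def by blast
  then show "primitive T" by (simp add: primitive_def)
qed

lemma topograph_iso_refl: "is_topograph T \<Longrightarrow> (T, T) \<in> topograph_iso"
  by (auto simp: topograph_iso_def intro!: exI[of _ id])

lemma topograph_iso_configuration:
  assumes "(T, T') \<in> topograph_iso"
  obtains f where "bij_betw f (darts T) (darts T')"
    "\<And>d. d \<in> darts T \<Longrightarrow> configuration T' (f d) = configuration T d"
proof -
  obtain f where T: "is_topograph T" and f: "bij_betw f (darts T) (darts T')"
    "\<forall>d\<in>darts T. f (flip T d) = flip T' (f d) \<and> f (turn T d) = turn T' (f d) \<and>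
       lab T' (f d) = lab T d"
    using assms by (auto simp: topograph_iso_def)
  have "configuration T' (f d) = configuration T d" if "d \<in> darts T" for d
  proof -
    note D = dart_systemD(1,3)[OF dart_system_topograph[OF T] that]
    have "lab T' (flip T' (f d)) = lab T (flip T d)" "lab T' (turn T' (f d)) = lab T (turn T d)"
      using f(2) that D by metis+
    then show ?thesis
      using f(2) that by (simp add: configuration_def edge_lab_def tail_lab_def)
  qed
  with f that show ?thesis by blast
qed

text \<open>Symmetry and transitivity use a single pair of darts with equal configurations, so no
  inverse or composite isomorphism has to be checked.\<close>

lemma equiv_topograph_iso: "equiv {T :: 'd topograph. is_topograph T} topograph_iso"
  (is "equiv ?A ?r")
proof (rule equivI)
  show "?r \<subseteq> ?A \<times> ?A"
    by (auto simp: topograph_iso_def)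
  show "refl_on ?A ?r"
    by (auto simp: refl_on_def topograph_iso_refl)
  have darts: "\<exists>d. d \<in> darts T" if "is_topograph T" for T :: "'d topograph"
    using that by (auto simp: is_topograph_def plane_cubic_tree_def)
  show "sym ?r"
  proof (rule symI)
    fix T T' :: "'d topograph" assume TT': "(T, T') \<in> topograph_iso"
    obtain f where f: "bij_betw f (darts T) (darts T')"
      "\<And>d. d \<in> darts T \<Longrightarrow> configuration T' (f d) = configuration T d"
      using topograph_iso_configuration[OF TT'] by blast
    have T: "is_topograph T" "is_topograph T'" using TT' by (auto simp: topograph_iso_def)
    then obtain d where d: "d \<in> darts T" using darts by blast
    then have "f d \<in> darts T'" using f(1) by (auto simp: bij_betw_def)
    with d f(2) T show "(T', T) \<in> topograph_iso"
      by (intro topograph_iso_if_configuration_eq[of _ _ "f d" d]) auto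
  qed
  show "trans ?r"
  proof (rule transI)
    fix T1 T2 T3 :: "'d topograph"
    assume 12: "(T1, T2) \<in> topograph_iso" and 23: "(T2, T3) \<in> topograph_iso"
    obtain f where f: "bij_betw f (darts T1) (darts T2)"
      "\<And>d. d \<in> darts T1 \<Longrightarrow> configuration T2 (f d) = configuration T1 d"
      using topograph_iso_configuration[OF 12] by blast
    obtain g where g: "bij_betw g (darts T2) (darts T3)"
      "\<And>d. d \<in> darts T2 \<Longrightarrow> configuration T3 (g d) = configuration T2 d"
      using topograph_iso_configuration[OF 23] by blast
    have T: "is_topograph T1" "is_topograph T3" using 12 23 by (auto simp: topograph_iso_def)
    then obtain d where d: "d \<in> darts T1" using darts by blast
    then have "f d \<in> darts T2" "g (f d) \<in> darts T3"
      using f(1) g(1) by (auto simp: bij_betw_def)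
    with d f(2) g(2) T show "(T1, T3) \<in> topograph_iso"
      by (intro topograph_iso_if_configuration_eq[of _ _ d "g (f d)"]) auto
  qed
qed

subsection \<open>The river\<close>

lemma configuration_left_turn_fstep:
  assumes "is_topograph T" "d \<in> darts T"
  shows "configuration T (left_turn T d) = fstep 0 (configuration T d)"
  using configuration_left_turn[OF assms] by (cases "configuration T d") simp

lemma configuration_right_turn_fstep:
  assumes "is_topograph T" "d \<in> darts T"
  shows "configuration T (right_turn T d) = fstep 1 (configuration T d)"
  using configuration_right_turn[OF assms] by (cases "configuration T d") simp

lemma turn_darts:
  assumes "is_topograph T" "d \<in> darts T"
  shows "left_turn T d \<in> darts T" "right_turn T d \<in> darts T"
  using dart_systemD[OF dart_system_topograph[OF assms(1)]] assms(2)
  by (auto simp: left_turn_def right_turn_def)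

lemma river_iff: "d \<in> river T \<longleftrightarrow> d \<in> darts T \<and> is_simple (configuration T d)"
  by (auto simp: river_def configuration_def)

lemma nonsquare_disc_configuration:
  assumes "T \<in> primitive_nonsquare_topographs" "d \<in> darts T"
  shows "nonsquare_disc (configuration T d)"
  using assms
  by (auto simp: primitive_nonsquare_topographs_def has_discriminant_def nonsquare_disc_def)

lemma primitive_configuration:
  assumes "T \<in> primitive_nonsquare_topographs" "d \<in> darts T"
  shows "primitive_form (configuration T d)"
  using assms primitive_iff_primitive_form[of T d]
  by (auto simp: primitive_nonsquare_topographs_def)

lemma primitive_nonsquare_topograph: "T \<in> primitive_nonsquare_topographs \<Longrightarrow> is_topograph T"
  by (auto simp: primitive_nonsquare_topographs_def)

lemma primitive_nonsquare_topographsI: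
  assumes "is_topograph T" "d \<in> darts T"
    "primitive_form (configuration T d)" "nonsquare_disc (configuration T d)"
  shows "T \<in> primitive_nonsquare_topographs"
proof -
  have "has_discriminant T (disc (configuration T d))"
    using disc_configuration[OF assms(1,2)] by (auto simp: has_discriminant_def)
  then show ?thesis using assms primitive_iff_primitive_form[OF assms(1,2)]
    by (auto simp: primitive_nonsquare_topographs_def nonsquare_disc_def)
qed

context
  fixes T :: "'d topograph"
  assumes T: "T \<in> primitive_nonsquare_topographs"
begin

lemma left_turn_river_iff:
  assumes "d \<in> river T"
  shows "left_turn T d \<in> river T \<longleftrightarrow> river_turn (configuration T d) = 0"
  using assms primitive_nonsquare_topograph[OF T]
  by (cases "configuration T d") (auto simp: river_iff configuration_left_turn_fstep turn_darts)

lemma river_letter_eq: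
  assumes "d \<in> river T"
  shows "river_letter T d = river_turn (configuration T d)"
  using left_turn_river_iff[OF assms] river_turn_binary[of "configuration T d"]
  by (auto simp: river_letter_def)

lemma configuration_river_next:
  assumes "d \<in> river T"
  shows "configuration T (river_next T d) = form_next (configuration T d)"
proof -
  note top = primitive_nonsquare_topograph[OF T]
  have d: "d \<in> darts T" using assms by (simp add: river_iff)
  show ?thesis
    using river_turn_binary[of "configuration T d"] configuration_left_turn_fstep[OF top d]
      configuration_right_turn_fstep[OF top d]
    by (auto simp: river_next_def left_turn_river_iff[OF assms] form_next_def)
qed

lemma river_next_river:
  assumes "d \<in> river T"
  shows "river_next T d \<in> river T"
proof -
  have "is_simple (configuration T (river_next T d))"
    using assms nonsquare_disc_configuration[OF T]
    by (auto simp: configuration_river_next river_iff intro: is_simple_form_next)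
  moreover have "river_next T d \<in> darts T"
    using assms primitive_nonsquare_topograph[OF T] by (auto simp: river_next_def river_iff turn_darts)
  ultimately show ?thesis by (simp add: river_iff)
qed

lemma funpow_river_next:
  assumes "d \<in> river T"
  shows "(river_next T ^^ k) d \<in> river T"
    "configuration T ((river_next T ^^ k) d) = (form_next ^^ k) (configuration T d)"
proof (induction k)
  case (Suc k)
  case 1 show ?case using Suc by (simp add: river_next_river)
  case 2 show ?case using Suc by (simp add: configuration_river_next)
qed (use assms in auto)

lemma river_word_eq_form_word:
  assumes "d \<in> river T"
  shows "river_word T d = form_word (configuration T d)"
proof -
  have "river_length T d = form_period (configuration T d)"
    by (simp add: river_length_def form_period_def funpow_river_next(2)[OF assms])
  then show ?thesis
    by (simp add: river_word_def form_word_def river_letter_eq funpow_river_next[OF assms])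
qed

lemma river_configuration:
  assumes "d \<in> river T"
  shows "is_simple (configuration T d)" "nonsquare_disc (configuration T d)"
    "primitive_form (configuration T d)"
  using assms nonsquare_disc_configuration[OF T] primitive_configuration[OF T]
  by (auto simp: river_iff)

text \<open>If no edge had labels of opposite signs on its sides, an edge minimizing the sum of their
  absolute values would have \<open>\<bar>b\<bar> \<le> min \<bar>a\<bar> \<bar>c\<bar>\<close>, hence negative discriminant.\<close>

lemma river_nonempty: "river T \<noteq> {}"
proof
  assume empty: "river T = {}"
  note top = primitive_nonsquare_topograph[OF T]
  note D = dart_systemD[OF dart_system_topograph[OF top]]
  let ?m = "\<lambda>d. nat (\<bar>lab T d\<bar> + \<bar>lab T (flip T d)\<bar>)"
  have conf: "configuration T d = (a, b, c) \<Longrightarrow> lab T d = a \<and> lab T (flip T d) = c" for d a b c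
    by (auto simp: configuration_def)
  obtain d0 where "d0 \<in> darts T"
    using top by (auto simp: is_topograph_def plane_cubic_tree_def)
  then obtain d where d: "d \<in> darts T" and least: "\<And>e. e \<in> darts T \<Longrightarrow> ?m d \<le> ?m e"
    using ex_has_least_nat[of "\<lambda>d. d \<in> darts T" d0 ?m] by blast
  have sign: "0 < a \<and> 0 < c \<or> a < 0 \<and> c < 0"
    if "e \<in> darts T" "configuration T e = (a, b, c)" for e a b c
    using empty that nonsquare_disc_configuration[OF T that(1)] D[OF that(1)]
      conf[OF that(2)] nonsquare_disc_sum_neq_0[of a b c]
    unfolding river_def by (auto simp: neq_iff)
  have least': "\<bar>a\<bar> + \<bar>c\<bar> \<le> \<bar>a'\<bar> + \<bar>c'\<bar>"
    if "configuration T d = (a, b, c)" "e \<in> darts T" "configuration T e = (a', b', c')"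
    for e a b c a' b' c'
    using least[OF that(2)] conf[OF that(1)] conf[OF that(3)] by (simp add: nat_le_eq_zle nat_le_iff)
  obtain a b c where q: "configuration T d = (a, b, c)" by (cases "configuration T d")
  have fd: "flip T d \<in> darts T" "configuration T (flip T d) = (c, - b, a)"
    using D[OF d] configuration_flip[OF top d] q by auto
  note e = turn_darts[OF top d] turn_darts[OF top fd(1)]
  note ce = configuration_left_turn[OF top d q] configuration_right_turn[OF top d q]
    configuration_left_turn[OF top fd] configuration_right_turn[OF top fd]
  note signs = sign[OF d q] sign[OF e(1) ce(1)] sign[OF e(2) ce(2)]
    sign[OF e(3) ce(3)] sign[OF e(4) ce(4)]
  note les = least'[OF q e(1) ce(1)] least'[OF q e(2) ce(2)]
    least'[OF q e(3) ce(3)] least'[OF q e(4) ce(4)]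
  \<comment> \<open>The four adjacent edges exchange \<open>a\<close> or \<open>c\<close> for
    \<open>a + b + c\<close> or \<open>a - b + c\<close>, all of the same sign; minimality says that
    none of these exchanges lowers the absolute value.\<close>
  have "\<bar>b\<bar> \<le> \<bar>a\<bar>" "\<bar>b\<bar> \<le> \<bar>c\<bar>" using signs les by linarith+
  then have "\<bar>b\<bar> * \<bar>b\<bar> \<le> \<bar>a\<bar> * \<bar>c\<bar>" by (intro mult_mono) auto
  moreover have "\<bar>a\<bar> * \<bar>c\<bar> = a * c" "a * c > 0"
    using signs(1) by (auto simp: mult_neg_neg)
  ultimately have "b\<^sup>2 - 4 * a * c < 0" by (simp add: power2_eq_square)
  moreover have "disc (configuration T d) > 0"
    using nonsquare_disc_configuration[OF T d] by (simp add: nonsquare_disc_def)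
  ultimately show False using q by (simp add: disc_def)
qed

text \<open>The river does not branch: the left turn stays on it only if
  \<open>a + b + c < 0\<close>, the right turn only if \<open>a + b + c > 0\<close>.\<close>

lemma river_next_eqI:
  assumes "d \<in> river T" "e \<in> river T" "e = left_turn T d \<or> e = right_turn T d"
  shows "river_next T d = e"
proof -
  have "\<not> (left_turn T d \<in> river T \<and> right_turn T d \<in> river T)"
    using assms(1) primitive_nonsquare_topograph[OF T]
    by (cases "configuration T d")
      (auto simp: river_iff configuration_left_turn_fstep configuration_right_turn_fstep)
  then show ?thesis using assms by (auto simp: river_next_def)
qed

text \<open>Off the river a walk climbs: once the edge label and both region labels have the same sign,
  they keep it.\<close>

fun climbing :: "int \<times> int \<times> int \<Rightarrow> bool" where
  "climbing (a, b, c) \<longleftrightarrow> a > 0 \<and> b > 0 \<and> c > 0 \<or> a < 0 \<and> b < 0 \<and> c < 0"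

lemma climbing_fstep: "climbing q \<Longrightarrow> climbing (fstep l q)"
  by (cases q) auto

lemma walk_from_river:
  assumes "x \<in> river T" "(x, y) \<in> (walk_rel T)\<^sup>*"
  shows "y \<in> river T \<and> (\<exists>k. (river_next T ^^ k) x = y) \<or> climbing (configuration T y)"
  using assms(2)
proof induction
  case base
  show ?case using assms(1) by (metis funpow_0)
next
  case (step y z)
  note top = primitive_nonsquare_topograph[OF T]
  have y: "y \<in> darts T" and z: "z = left_turn T y \<or> z = right_turn T y"
    using step(2) by (auto simp: walk_rel_def)
  have zd: "z \<in> darts T" using z turn_darts[OF top y] by auto
  have conf: "configuration T z = fstep 0 (configuration T y) \<or>
      configuration T z = fstep 1 (configuration T y)"
    using z configuration_left_turn_fstep[OF top y] configuration_right_turn_fstep[OF top y] by auto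
  from step.IH show ?case
  proof
    assume y_riv: "y \<in> river T \<and> (\<exists>k. (river_next T ^^ k) x = y)"
    show ?thesis
    proof (cases "z \<in> river T")
      case True
      then have "river_next T y = z" using y_riv z river_next_eqI by blast
      moreover obtain k where "(river_next T ^^ k) x = y" using y_riv by blast
      ultimately have "(river_next T ^^ Suc k) x = z" by simp
      with True show ?thesis by blast
    next
      case False
      obtain a b c where q: "configuration T y = (a, b, c)" by (cases "configuration T y")
      have "a + b + c \<noteq> 0"
        using nonsquare_disc_configuration[OF T y] q nonsquare_disc_sum_neq_0 by simp
      moreover have "a > 0" "c < 0" using y_riv q by (auto simp: river_iff)
      \<comment> \<open>Leaving by a left turn means \<open>a + b + c > 0\<close>; with
        \<open>c < 0\<close> this gives \<open>a + b > 0\<close> and hence a positive edge label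
        \<open>b + 2 * a\<close>. The right turn is the mirror image with negative signs.\<close>
      ultimately have "climbing (configuration T z)"
        using conf False zd q by (auto simp: river_iff)
      then show ?thesis ..
    qed
  next
    assume "climbing (configuration T y)"
    then show ?thesis using conf climbing_fstep by metis
  qed
qed

text \<open>The upstream counterpart: the walk starts against the direction of the river, so the
  reversed dart it reaches flows down to the reversed start.\<close>

lemma walk_to_river:
  assumes "x \<in> darts T" "flip T x \<in> river T" "(x, y) \<in> (walk_rel T)\<^sup>*"
  shows "flip T y \<in> river T \<and> (\<exists>k. (river_next T ^^ k) (flip T y) = flip T x) \<or>
    climbing (configuration T y)"
  using assms(3)
proof induction
  case base
  show ?case using assms(2) by (metis funpow_0)
next
  case (step y z)
  note top = primitive_nonsquare_topograph[OF T]
  note D = dart_systemD[OF dart_system_topograph[OF top]]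
  have y: "y \<in> darts T" and z: "z = left_turn T y \<or> z = right_turn T y"
    using step(2) by (auto simp: walk_rel_def)
  have zd: "z \<in> darts T" using z turn_darts[OF top y] by auto
  have conf: "configuration T z = fstep 0 (configuration T y) \<or>
      configuration T z = fstep 1 (configuration T y)"
    using z configuration_left_turn_fstep[OF top y] configuration_right_turn_fstep[OF top y] by auto
  from step.IH show ?case
  proof
    assume y_riv: "flip T y \<in> river T \<and> (\<exists>k. (river_next T ^^ k) (flip T y) = flip T x)"
    show ?thesis
    proof (cases "flip T z \<in> river T")
      case True
      have "flip T y = left_turn T (flip T z) \<or> flip T y = right_turn T (flip T z)"
        using z D[OF y] D[OF zd] D[OF D(1)[OF y]] by (auto simp: left_turn_def right_turn_def)
      then have "river_next T (flip T z) = flip T y" using True y_riv river_next_eqI by blast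
      moreover obtain k where "(river_next T ^^ k) (flip T y) = flip T x" using y_riv by blast
      ultimately have "(river_next T ^^ Suc k) (flip T z) = flip T x"
        by (simp add: funpow_swap1)
      with True show ?thesis by blast
    next
      case False
      obtain a b c where q: "configuration T y = (a, b, c)" by (cases "configuration T y")
      have "a + b + c \<noteq> 0"
        using nonsquare_disc_configuration[OF T y] q nonsquare_disc_sum_neq_0 by simp
      moreover have "a < 0" "c > 0"
        using y_riv q configuration_flip[OF top y] by (auto simp: river_iff)
      ultimately have "climbing (configuration T z)"
        using conf False D(1)[OF zd] q configuration_flip[OF top zd] by (auto simp: river_iff)
      then show ?thesis ..
    qed
  next
    assume "climbing (configuration T y)"
    then show ?thesis using conf climbing_fstep by metis
  qed
qed

text \<open>A normalized walk joins the two edges in some direction. It cannot leave the river,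
  because a climbing dart has labels of equal sign on its sides whereas \<open>e\<close> does not;
  so it runs downstream or upstream along it.\<close>

lemma river_connected:
  assumes "d \<in> river T" "e \<in> river T"
  shows "(\<exists>k. (river_next T ^^ k) d = e) \<or> (\<exists>k. (river_next T ^^ k) e = d)"
proof -
  note top = primitive_nonsquare_topograph[OF T]
  have d: "d \<in> darts T" and e: "e \<in> darts T" using assms by (auto simp: river_iff)
  note D = dart_systemD[OF dart_system_topograph[OF top]]
  note flips = D(1,2)[OF d] D(1,2)[OF e]
  have no_climb: "\<not> climbing (configuration T e)" "\<not> climbing (configuration T (flip T e))"
    using assms(2) configuration_flip[OF top e]
    by (cases "configuration T e"; auto simp: river_iff)+
  have no_river: "flip T e \<notin> river T" using assms(2) flips by (auto simp: river_def)
  have "plane_cubic_tree T" using top by (simp add: is_topograph_def)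
  from walk_normal_form[OF dart_system_topograph[OF top] d dart_connected[OF this d e]]
  consider "(d, e) \<in> (walk_rel T)\<^sup>*" | "(d, flip T e) \<in> (walk_rel T)\<^sup>*"
    | "(flip T d, e) \<in> (walk_rel T)\<^sup>*" | "(flip T d, flip T e) \<in> (walk_rel T)\<^sup>*"
    by blast
  then show ?thesis
  proof cases
    case 1
    then show ?thesis using walk_from_river[OF assms(1)] no_climb by blast
  next
    case 2
    then show ?thesis using walk_from_river[OF assms(1)] no_climb no_river by blast
  next
    case 3
    then show ?thesis using walk_to_river[of "flip T d"] flips assms(1) no_climb no_river by metis
  next
    case 4
    then show ?thesis using walk_to_river[of "flip T d"] flips assms(1) no_climb no_river by metis
  qed
qed

end

section \<open>The induced map on isomorphism classes\<close>

lemma necklace_rotate: "necklace (rotate k w) = necklace w"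
proof -
  have "rotate i w \<in> necklace (rotate k w)" for i
  proof -
    let ?n = "length w"
    \<comment> \<open>Rotating by \<open>k * ?n - k\<close>, a natural number for a nonempty word,
      undoes the rotation by \<open>k\<close>.\<close>
    have "rotate (i + (k * ?n - k)) (rotate k w) = rotate i w" if "w \<noteq> []"
    proof -
      have "k \<le> k * ?n" using that by (cases w) auto
      then have "i + (k * ?n - k) + k = i + k * ?n" by (simp only: add.assoc le_add_diff_inverse2)
      then have "rotate (i + (k * ?n - k)) (rotate k w) = rotate (i + k * ?n) w"
        by (simp only: rotate_rotate)
      also have "\<dots> = rotate i w"
        by (metis mod_mult_self1 rotate_conv_mod mult.commute)
      finally show ?thesis .
    qed
    then have "\<exists>j. rotate i w = rotate j (rotate k w)"
      by (cases "w = []") (simp, metis)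
    then show ?thesis unfolding necklace_def by simp
  qed
  then show ?thesis by (auto simp: necklace_def rotate_rotate)
qed

lemma river_word_necklace:
  assumes T: "T \<in> primitive_nonsquare_topographs" and "d \<in> river T" "e \<in> river T"
  shows "necklace (form_word (configuration T d)) = necklace (form_word (configuration T e))"
proof -
  have "form_word (configuration T ((river_next T ^^ k) x)) = rotate k (form_word (configuration T x))"
    if "x \<in> river T" for x k
    using funpow_river_next(2)[OF T that] form_word_funpow river_configuration[OF T that] by simp
  then show ?thesis using river_connected[OF assms] assms necklace_rotate by metis
qed

lemma iso_primitive_nonsquare:
  assumes "(T, T') \<in> topograph_iso" "T \<in> primitive_nonsquare_topographs"
  shows "T' \<in> primitive_nonsquare_topographs"
proof -
  obtain f where f: "bij_betw f (darts T) (darts T')"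
    "\<And>d. d \<in> darts T \<Longrightarrow> configuration T' (f d) = configuration T d"
    using topograph_iso_configuration[OF assms(1)] by blast
  obtain d where d: "d \<in> darts T" using river_nonempty[OF assms(2)] by (auto simp: river_iff)
  then have "f d \<in> darts T'" using f(1) by (auto simp: bij_betw_def)
  with f(2)[OF d] show ?thesis
    using primitive_nonsquare_topographsI[of T' "f d"] assms(1) d primitive_configuration[OF assms(2)]
      nonsquare_disc_configuration[OF assms(2)] by (auto simp: topograph_iso_def)
qed

text \<open>All representatives and all starting edges contribute the same necklace: isomorphisms
  carry river edges to river edges with equal configurations, and the river is connected.\<close>

lemma river_sequence_eq:
  assumes T: "T \<in> primitive_nonsquare_topographs" and d: "d \<in> river T"
  shows "river_sequence (topograph_iso `` {T}) = necklace (form_word (configuration T d))"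
proof -
  have eq: "necklace (river_word T' d') = necklace (form_word (configuration T d))"
    if iso: "(T, T') \<in> topograph_iso" and d': "d' \<in> river T'" for T' d'
  proof -
    obtain f where f: "bij_betw f (darts T) (darts T')"
      "\<And>d. d \<in> darts T \<Longrightarrow> configuration T' (f d) = configuration T d"
      using topograph_iso_configuration[OF iso] by blast
    have "f d \<in> river T'" using d f by (auto simp: river_iff bij_betw_def)
    moreover have T': "T' \<in> primitive_nonsquare_topographs"
      using iso_primitive_nonsquare[OF iso T] .
    moreover have "configuration T' (f d) = configuration T d"
      using f(2) d by (simp add: river_iff)
    ultimately show ?thesis
      using river_word_necklace[OF T' d', of "f d"] river_word_eq_form_word[OF T' d'] by simp
  qed
  have "(T, T) \<in> topograph_iso"
    using topograph_iso_refl[OF primitive_nonsquare_topograph[OF T]] .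
  with d eq show ?thesis unfolding river_sequence_def by fastforce
qed

subsection \<open>Existence of a topograph with a given configuration\<close>

text \<open>A dart of the universal topograph is the map taking the configuration at a base dart to the
  configuration at this dart.\<close>

fun dart_map :: "bool list \<Rightarrow> int \<times> int \<times> int \<Rightarrow> int \<times> int \<times> int" where
  "dart_map [] = id"
| "dart_map (x # xs) = (if x then form_flip else form_turn) \<circ> dart_map xs"

lemma form_flip_flip: "form_flip (form_flip q) = q"
  by (cases q) auto

lemma form_turn_turn_turn: "form_turn (form_turn (form_turn q)) = q"
  by (cases q) auto

lemma right_turn_form: "form_turn (form_flip q) = fstep 1 q"
  by (cases q) (auto simp: algebra_simps)

lemma left_turn_form: "form_turn (form_turn (form_flip q)) = fstep 0 q"
  by (cases q) (auto simp: algebra_simps)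

lemma surj_dart_map: "surj (dart_map xs)"
proof (induction xs)
  case (Cons x xs)
  have "surj form_flip" "surj form_turn"
    using surjI[of form_flip form_flip] surjI[of form_turn "\<lambda>q. form_turn (form_turn q)"]
    by (auto simp: form_flip_flip form_turn_turn_turn simp del: form_flip.simps form_turn.simps)
  then show ?case using Cons unfolding dart_map.simps by (cases x) (simp_all only: if_True if_False comp_surj)
qed auto

lemma dart_map_closed:
  assumes "g \<in> range dart_map"
  shows "form_flip \<circ> g \<in> range dart_map" "form_turn \<circ> g \<in> range dart_map"
proof -
  obtain xs where g: "g = dart_map xs" using assms by blast
  show "form_flip \<circ> g \<in> range dart_map" by (rule range_eqI[of _ _ "True # xs"]) (simp add: g)
  show "form_turn \<circ> g \<in> range dart_map" by (rule range_eqI[of _ _ "False # xs"]) (simp add: g)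
qed

text \<open>The test form is x^2 + y^2. Fixing it gives \<open>p\<^sup>2 + s\<^sup>2 = 1\<close> and
  \<open>r\<^sup>2 + t\<^sup>2 = 1\<close>, and with \<open>p, t \<ge> 1\<close> the off-diagonal
  entries vanish, contrary to any letter.\<close>

lemma word_act_not_identity:
  assumes "w \<noteq> []"
  shows "word_act w (1, 0, 1) \<noteq> (1, 0, 1)"
proof
  assume fixed: "word_act w (1, 0, 1) = (1, 0, 1)"
  obtain p r s t where w: "word_mat w = (p, r, s, t)" by (cases "word_mat w") auto
  note props = word_mat_props[OF w]
  have "p\<^sup>2 + s\<^sup>2 = 1" "r\<^sup>2 + t\<^sup>2 = 1"
    using fixed unfolding word_act_eq_substitution[OF w] by auto
  moreover have "p\<^sup>2 \<ge> 1" "t\<^sup>2 \<ge> 1" using props by (auto simp: self_le_power one_le_power)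
  ultimately have "s\<^sup>2 \<le> 0" "r\<^sup>2 \<le> 0" by linarith+
  then have "s = 0" "r = 0" by auto
  obtain l where "l \<in> set w" using assms by (cases w) auto
  then have "0 \<in> set w \<or> (\<exists>l\<in>set w. l \<noteq> 0)" by (cases "l = 0") auto
  with props \<open>s = 0\<close> \<open>r = 0\<close> show False by linarith
qed

lemma obtain_topograph:
  assumes "infinite (UNIV :: 'd set)"
  obtains T :: "'d topograph" and d where "is_topograph T" "d \<in> darts T" "configuration T d = q"
proof -
  let ?G = "range dart_map"
  obtain h :: "nat \<Rightarrow> 'd" where "inj h" using infinite_countable_subset[OF assms] by blast
  \<comment> \<open>Darts are countably many, one word being chosen for each map, so they embed into
    the infinite type \<open>'d\<close>; \<open>k\<close> decodes. The labels in \<open>T\<close>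
    evaluate the decoded map at \<open>q\<close>, so one tree serves every form.\<close>
  define i where "i = h \<circ> to_nat \<circ> inv dart_map"
  have inj: "inj_on i ?G"
    unfolding i_def using \<open>inj h\<close> inj_to_nat
    by (intro comp_inj_on inj_on_inv_into) (auto intro: inj_on_subset)
  define k where "k = inv_into ?G i"
  have ki: "k (i g) = g" if "g \<in> ?G" for g using that inj by (simp add: k_def)
  define T where "T = \<lparr>darts = i ` ?G, flip = (\<lambda>x. i (form_flip \<circ> k x)),
    turn = (\<lambda>x. i (form_turn \<circ> k x)), lab = (\<lambda>x. fst (k x q))\<rparr>"
  have [simp]: "darts T = i ` ?G" by (simp add: T_def)
  have flip: "flip T (i g) = i (form_flip \<circ> g)" and turn: "turn T (i g) = i (form_turn \<circ> g)"
    and lab: "lab T (i g) = fst (g q)" if "g \<in> ?G" for g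
    using ki[OF that] by (auto simp: T_def)
  note closed = dart_map_closed
  have flip2: "form_flip \<circ> (form_flip \<circ> g) = g"
    and turn3: "form_turn \<circ> (form_turn \<circ> (form_turn \<circ> g)) = g" for g :: "'e \<Rightarrow> int \<times> int \<times> int"
    by (simp_all add: fun_eq_iff form_flip_flip form_turn_turn_turn)
  have onto: "\<exists>p. g p = r" if "g \<in> ?G" for g r
  proof -
    have "surj g" using that surj_dart_map by blast
    from surjD[OF this, of r] show ?thesis by (auto dest: sym)
  qed
  have ne: "form_flip \<circ> g \<noteq> g" "form_turn \<circ> g \<noteq> g" if g: "g \<in> ?G" for g
  proof -
    \<comment> \<open>A form moved by both generators: they send it to \<open>(0, 0, 1)\<close> and
      \<open>(1, 2, 1)\<close>. Surjectivity of \<open>g\<close> lets any form be used as a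
      test.\<close>
    obtain p where "g p = (1, 0, 0)" using onto[OF g] by blast
    then have "(form_flip \<circ> g) p \<noteq> g p" "(form_turn \<circ> g) p \<noteq> g p" by auto
    then show "form_flip \<circ> g \<noteq> g" "form_turn \<circ> g \<noteq> g" by metis+
  qed
  have iinj: "i g = i g' \<longleftrightarrow> g = g'" if "g \<in> ?G" "g' \<in> ?G" for g g'
    using inj that by (rule inj_on_eq_iff)
  have sys: "dart_system T"
    unfolding dart_system_def
    by (auto simp: flip turn closed flip2 turn3)
  have right: "right_turn T (i g) = i (fstep 1 \<circ> g)"
    and left: "left_turn T (i g) = i (fstep 0 \<circ> g)"
    and closed': "fstep 1 \<circ> g \<in> ?G" "fstep 0 \<circ> g \<in> ?G" if "g \<in> ?G" for g
  proof -
    have 1: "fstep 1 \<circ> g = form_turn \<circ> (form_flip \<circ> g)"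
      by (rule ext) (simp only: comp_apply right_turn_form)
    have 0: "fstep 0 \<circ> g = form_turn \<circ> (form_turn \<circ> (form_flip \<circ> g))"
      by (rule ext) (simp only: comp_apply left_turn_form)
    show "right_turn T (i g) = i (fstep 1 \<circ> g)" "left_turn T (i g) = i (fstep 0 \<circ> g)"
      unfolding right_turn_def left_turn_def 0 1 using that by (simp_all add: flip turn closed)
    show "fstep 1 \<circ> g \<in> ?G" "fstep 0 \<circ> g \<in> ?G"
      unfolding 0 1 by (intro closed that)+
  qed
  have reach: "(i id, i (dart_map xs)) \<in> (dart_step T)\<^sup>*" for xs
  proof (induction xs)
    case (Cons x xs)
    have "(i (dart_map xs), i (dart_map (x # xs))) \<in> dart_step T"
      by (auto simp: dart_step_def flip turn)
    with Cons show ?case by (rule rtrancl_into_rtrancl)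
  qed simp
  have conn: "(d, e) \<in> (dart_step T)\<^sup>*" if "d \<in> darts T" "e \<in> darts T" for d e
    using that reach dart_step_sym[OF sys reach] by (auto intro: rtrancl_trans)
  have walk: "\<exists>g w. g \<in> ?G \<and> w \<noteq> [] \<and> d = i g \<and> word_act w \<circ> g \<in> ?G \<and> e = i (word_act w \<circ> g)"
    if "(d, e) \<in> (walk_rel T)\<^sup>+" for d e
  proof -
    have walk_step: "\<exists>l. fstep l \<circ> g \<in> ?G \<and> y = i (fstep l \<circ> g)"
      if "(i g, y) \<in> walk_rel T" "g \<in> ?G" for g y
      using that(1) right[OF that(2)] left[OF that(2)] closed'[OF that(2)]
      unfolding walk_rel_def by blast
    show ?thesis using that
    proof induction
      case (base y)
      then obtain g where g: "g \<in> ?G" "d = i g" by (auto simp: walk_rel_def)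
      with walk_step base obtain l where "fstep l \<circ> g \<in> ?G" "y = i (fstep l \<circ> g)" by blast
      moreover have "fstep l \<circ> g = word_act [l] \<circ> g" by auto
      ultimately show ?case using g by (metis list.distinct(1))
    next
      case (step y z)
      then obtain g w where g: "g \<in> ?G" "w \<noteq> []" "d = i g" "word_act w \<circ> g \<in> ?G"
        "y = i (word_act w \<circ> g)" by blast
      then obtain l where l: "fstep l \<circ> (word_act w \<circ> g) \<in> ?G" "z = i (fstep l \<circ> (word_act w \<circ> g))"
        using step.hyps(2) walk_step by blast
      have "fstep l \<circ> (word_act w \<circ> g) = word_act (w @ [l]) \<circ> g"
        by (auto simp: word_act_append)
      with g l show ?case by (metis append_is_Nil_conv)
    qed
  qed
  have "acyclic (walk_rel T)"
    unfolding acyclic_def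
  proof (intro allI notI)
    fix d assume "(d, d) \<in> (walk_rel T)\<^sup>+"
    \<comment> \<open>A circuit makes the action of a nonempty word trivial on the range of
      \<open>g\<close>, which consists of all forms.\<close>
    from walk[OF this] obtain g w where g: "g \<in> ?G" "w \<noteq> []" "word_act w \<circ> g = g"
      using iinj by metis
    obtain p where "g p = (1, 0, 1)" using onto[OF g(1)] by blast
    then have "word_act w (1, 0, 1) = (1, 0, 1)" using fun_cong[OF g(3), of p] by simp
    with word_act_not_identity[OF g(2)] show False by simp
  qed
  then have "plane_cubic_tree T"
    using conn dart_systemD[OF sys] ne
    unfolding plane_cubic_tree_def dart_step_def
    by (auto simp: flip turn iinj closed flip2 turn3)
  moreover have "lab T (left_turn T (i g)) = lab T (i g)" if "g \<in> ?G" for g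
    using that by (cases "g q") (simp add: left lab closed')
  moreover have "tail_lab T (i g) + head_lab T (i g) = 2 * (lab T (i g) + lab T (flip T (i g)))"
    if "g \<in> ?G" for g
    using that unfolding tail_lab_def head_lab_def right[OF that]
    by (cases "g q") (simp add: flip turn lab closed closed' del: One_nat_def)
  ultimately have "is_topograph T" by (auto simp: is_topograph_def)
  moreover have id: "id \<in> ?G" by (metis dart_map.simps(1) rangeI)
  moreover have "configuration T (i id) = q"
    unfolding configuration_def edge_lab_def tail_lab_def flip[OF id] turn[OF id] lab[OF id]
      lab[OF closed(1)[OF id]] lab[OF closed(2)[OF id]]
    by (cases q) simp
  ultimately show ?thesis using that[of T "i id"] by auto
qed

theorem theorem8p11:
  assumes "infinite (UNIV :: 'd set)"
  shows "bij_betw river_sequence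
           ((primitive_nonsquare_topographs :: 'd topograph set) // topograph_iso)
           nonrepeating_binary_necklaces"
proof (rule bij_betwI')
  fix C C' assume "C \<in> (primitive_nonsquare_topographs :: 'd topograph set) // topograph_iso"
    "C' \<in> (primitive_nonsquare_topographs :: 'd topograph set) // topograph_iso"
  then obtain T T' :: "'d topograph"
    where T: "T \<in> primitive_nonsquare_topographs" "C = topograph_iso `` {T}"
      and T': "T' \<in> primitive_nonsquare_topographs" "C' = topograph_iso `` {T'}"
    by (auto elim!: quotientE)
  obtain d d' where d: "d \<in> river T" and d': "d' \<in> river T'"
    using river_nonempty[OF T(1)] river_nonempty[OF T'(1)] by blast
  note q = river_configuration[OF T(1) d] and q' = river_configuration[OF T'(1) d']
  show "river_sequence C = river_sequence C' \<longleftrightarrow> C = C'"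
  proof
    assume "river_sequence C = river_sequence C'"
    then have "necklace (form_word (configuration T d)) = necklace (form_word (configuration T' d'))"
      using river_sequence_eq[OF T(1) d] river_sequence_eq[OF T'(1) d'] T T' by simp
    moreover have "w \<in> necklace w" for w :: "nat list"
      unfolding necklace_def by (auto intro: exI[of _ 0])
    ultimately obtain k where k: "form_word (configuration T' d') = rotate k (form_word (configuration T d))"
      unfolding necklace_def by blast
    \<comment> \<open>Moving the starting edge \<open>k\<close> steps downstream turns equality of
      necklaces into equality of words.\<close>
    define e where "e = (river_next T ^^ k) d"
    have e: "e \<in> river T" unfolding e_def by (rule funpow_river_next[OF T(1) d])
    have "form_word (configuration T e) = form_word (configuration T' d')"
      unfolding e_def funpow_river_next(2)[OF T(1) d] k using form_word_funpow q by blast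
    then have "configuration T e = configuration T' d'"
      using form_word_inject_primitive river_configuration[OF T(1) e] q' by blast
    then have "(T, T') \<in> topograph_iso"
      using topograph_iso_if_configuration_eq e d' T T' primitive_nonsquare_topograph
      by (metis river_iff)
    then show "C = C'" using T T' equiv_class_eq[OF equiv_topograph_iso] by metis
  qed simp
next
  fix C assume "C \<in> (primitive_nonsquare_topographs :: 'd topograph set) // topograph_iso"
  then obtain T :: "'d topograph"
    where T: "T \<in> primitive_nonsquare_topographs" "C = topograph_iso `` {T}"
    by (auto elim!: quotientE)
  obtain d where d: "d \<in> river T" using river_nonempty[OF T(1)] by blast
  note q = river_configuration[OF T(1) d]
  show "river_sequence C \<in> nonrepeating_binary_necklaces"
    using river_sequence_eq[OF T(1) d] T(2) form_word_binary form_period_ge_2[OF q(1,2)]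
      form_word_nonrepeating[OF q(1,2)]
    unfolding nonrepeating_binary_necklaces_def
    by (intro CollectI exI[of _ "form_word (configuration T d)"]) simp
next
  fix N :: "nat list set" assume "N \<in> nonrepeating_binary_necklaces"
  then obtain w where N: "N = necklace w" and w: "w \<in> lists {0, 1}" "length w \<ge> 2" "\<not> repeating w"
    by (auto simp: nonrepeating_binary_necklaces_def)
  obtain q where q: "is_simple q" "nonsquare_disc q" "primitive_form q" "form_word q = w"
    using form_word_surj[OF w] .
  obtain T :: "'d topograph" and d where T: "is_topograph T" "d \<in> darts T" "configuration T d = q"
    using obtain_topograph[OF assms] .
  have pns: "T \<in> primitive_nonsquare_topographs"
    using primitive_nonsquare_topographsI[OF T(1,2)] q T(3) by simp
  have "river_sequence (topograph_iso `` {T}) = N"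
    using river_sequence_eq[OF pns, of d] T q N by (simp add: river_iff)
  then show "\<exists>C\<in>(primitive_nonsquare_topographs :: 'd topograph set) // topograph_iso.
      N = river_sequence C"
    using pns by (metis quotientI)
qed

end
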